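(* Let $\Psi=(\psi_n)_{n=1}^\infty$ and $\Phi=(\phi_n)_{n=1}^\infty$ be Bessel sequences in separable Hilbert spaces $\mathcal{H}_1$ and $\mathcal{H}_2$, respectively, and let $m=(m_n)_{n=1}^\infty\subseteq\mathbb{C}$ be semi-normalized. Assume that the multiplier $M:=M_{m,\Phi,\Psi}:\mathcal{H}_1\to\mathcal{H}_2$ has closed range, and let $W\subseteq\mathcal{H}_1$, $V\subseteq\mathcal{H}_2$ be closed subspaces with $\mathcal{H}_1=W\oplus\ker(M)$ and $\mathcal{H}_2=\operatorname{ran}(M)\oplus V$. Let $M^{\#}_{W,V}:\mathcal{H}_2\to\mathcal{H}_1$ be the oblique pseudoinverse of $M$ on $W$ along $V$, and put $\Psi^{\#}:=(M^{\#}_{W,V}(m_n\phi_n))_{n=1}^\infty$ and $\Phi^{\#}:=((M^{\#}_{W,V})^*(\overline{m_n}\psi_n))_{n=1}^\infty$. Then the following statements hold. (i) If $F$ is a Bessel sequence in $V^\perp$ such that $M^{\#}_{W,V}=M_{1/m,\Psi^{\#},F}$, then $F$ is an oblique dual frame of $\pi_{\operatorname{ran}(M),V}\Phi$ on $V^\perp$. (ii) If $G$ is a Bessel sequence in $W$ such that $M^{\#}_{W,V}=M_{1/m,G,\Phi^{\#}}$, then $G$ is an oblique dual frame of $\pi^*_{W,\ker(M)}\Psi$ on $W$. (iii) The sequence $\Psi^{\#}$ is the only Bessel sequence $G$ in $W$ satisfying $M^{\#}_{W,V}=M_{1/m,G,\Phi^{\mathrm{od}}}$ for every oblique dual frame $\Phi^{\mathrm{od}}$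 of $\pi_{\operatorname{ran}(M),V}\Phi$ on $V^\perp$. (iv) The sequence $\Phi^{\#}$ is the only Bessel sequence $F$ in $V^\perp$ satisfying $M^{\#}_{W,V}=M_{1/m,\Psi^{\mathrm{od}},F}$ for every oblique dual frame $\Psi^{\mathrm{od}}$ of $\pi^*_{W,\ker(M)}\Psi$ on $W$.
   Context: Here $X\oplus Y$ denotes a direct sum, not necessarily orthogonal. A sequence $(x_n)$ in a closed subspace $X$ of a Hilbert space $\mathcal{H}$ is a Bessel sequence in $X$ if there is $B>0$ with $\sum_n|\langle h,x_n\rangle|^2\le B\|h\|^2$ for all $h\in X$ (it is then Bessel in $\mathcal{H}$), and a frame for $X$ if moreover $A\|h\|^2\le\sum_n|\langle h,x_n\rangle|^2$ for some $A>0$ and all $h\in X$. For a Bessel sequence $F=(f_n)$ in $\mathcal{H}$, $T_F:\ell^2(\mathbb{N})\to\mathcal{H}$, $T_F(c_n)=\sum_n c_nf_n$, is the synthesis operator; its adjoint is $T_F^*h=(\langle h,f_n\rangle)_n$. For sequences $\Psi$ in $\mathcal{H}_1$, $\Phi$ in $\mathcal{H}_2$ and scalars $m$, the multiplier is $M_{m,\Phi,\Psi}h=\sum_n m_n\langle h,\psi_n\rangle\phi_n$ (second index: synthesis sequence; third index: analysis sequence). For Bessel sequences and bounded $m$ it is a bounded operator. The sequence $m$ is semi-normalized if $0<\inf_n|m_n|\le\sup_n|m_n|<\infty$; $1/m=(1/m_n)_n$. If $\mathcal{H}=X\oplus Z$ with $X,Z$ closed, $\pi_{X,Z}$ is the oblique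 projection onto $X$ along $Z$: $\pi_{X,Z}(x+z)=x$ for $x\in X$, $z\in Z$. For an operator $L$ and sequence $F=(f_n)$, $LF:=(Lf_n)_n$. Oblique dual frames: let $W_1,W_2$ be closed subspaces of $\mathcal{H}$ with $\mathcal{H}=W_1\oplus W_2^\perp$. If $F$ is a frame for $W_1$ and $G$ is a frame for $W_2$, then $F$ is an oblique dual frame of $G$ on $W_1$ if $T_FT_G^*=\pi_{W_1,W_2^\perp}$. (The sequences $\pi_{\operatorname{ran}(M),V}\Phi$ and $\pi^*_{W,\ker(M)}\Psi$ are frames for $\operatorname{ran}(M)$ and $\ker(M)^\perp$, respectively, so here $(W_1,W_2)=(V^\perp,\operatorname{ran}(M))$, respectively $(W,\ker(M)^\perp)$.) Oblique pseudoinverse: for a bounded operator $M:\mathcal{H}_1\to\mathcal{H}_2$ with closed range and closed subspaces $W,V$ with $\mathcal{H}_1=W\oplus\ker(M)$, $\mathcal{H}_2=\operatorname{ran}(M)\oplus V$, each $y\in\mathcal{H}_2$ can be written as $y=Mx_y+z_y$ with unique $x_y\in W$, $z_y\in V$; the oblique pseudoinverse of $M$ on $W$ along $V$ is $M^{\#}_{W,V}y:=x_y$. It is a bounded linear operator $\mathcal{H}_2\to\mathcal{H}_1$. *)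

theory Defs
  imports "HOL-Analysis.Analysis"
begin

text \<open>
  The libraries have only real inner product spaces. A complex one is a \<^class>\<open>real_inner\<close> space
  whose scalar multiplication extends to the complex numbers and whose real inner product is the
  real part of a Hermitian form; norm and topology are those of \<^class>\<open>real_inner\<close>.
  The form is linear in its first argument.
\<close>

class complex_inner = real_inner +
  fixes scaleC :: "complex \<Rightarrow> 'a \<Rightarrow> 'a"  (infixr \<open>*\<^sub>C\<close> 75)
    and cinner :: "'a \<Rightarrow> 'a \<Rightarrow> complex"
  assumes scaleC_add_right: "a *\<^sub>C (x + y) = a *\<^sub>C x + a *\<^sub>C y"
    and scaleC_add_left: "(a + b) *\<^sub>C x = a *\<^sub>C x + b *\<^sub>C x"
    and scaleC_scaleC: "a *\<^sub>C (b *\<^sub>C x) = (a * b) *\<^sub>C x"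
    and scaleC_of_real: "complex_of_real r *\<^sub>C x = r *\<^sub>R x"
    and cinner_commute: "cinner x y = cnj (cinner y x)"
    and cinner_add_left: "cinner (x + y) z = cinner x z + cinner y z"
    and cinner_scaleC_left: "cinner (a *\<^sub>C x) y = a * cinner x y"
    and Re_cinner: "Re (cinner x y) = inner x y"

class chilbert_space = complex_inner + banach

lemma cinner_self:
  fixes x :: "'a::complex_inner"
  shows "cinner x x = complex_of_real ((norm x)\<^sup>2)"
proof (rule complex_eqI)
  show "Re (cinner x x) = Re (complex_of_real ((norm x)\<^sup>2))"
    by (simp add: Re_cinner power2_norm_eq_inner)
  have "Im (cinner x x) = Im (cnj (cinner x x))"
    using cinner_commute[of x x] by simp
  then show "Im (cinner x x) = Im (complex_of_real ((norm x)\<^sup>2))"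
    by simp
qed

instantiation complex :: chilbert_space
begin

definition scaleC_complex :: "complex \<Rightarrow> complex \<Rightarrow> complex"
  where "scaleC_complex a x = a * x"

definition cinner_complex :: "complex \<Rightarrow> complex \<Rightarrow> complex"
  where "cinner_complex x y = x * cnj y"

instance
  by standard
    (auto simp: scaleC_complex_def cinner_complex_def inner_complex_def scaleR_conv_of_real algebra_simps)

end

global_interpretation complex_vector: vector_space "scaleC :: complex \<Rightarrow> 'a \<Rightarrow> 'a::complex_inner"
proof
  fix x :: 'a
  show "1 *\<^sub>C x = x"
    using scaleC_of_real[of 1 x] by simp
qed (simp_all add: scaleC_add_right scaleC_add_left scaleC_scaleC)

definition closed_csubspace :: "'a::complex_inner set \<Rightarrow> bool"
  where "closed_csubspace X \<longleftrightarrow> complex_vector.subspace X \<and> closed X"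

definition orth_compl :: "'a::complex_inner set \<Rightarrow> 'a set"
  where "orth_compl X = {h. \<forall>x\<in>X. cinner h x = 0}"

definition op_kernel :: "('a::complex_inner \<Rightarrow> 'b::complex_inner) \<Rightarrow> 'a set"
  where "op_kernel L = {x. L x = 0}"

text \<open>The whole space is the (not necessarily orthogonal) direct sum of the subspaces X and Z.\<close>

definition direct_sum_decomp :: "'a::complex_inner set \<Rightarrow> 'a set \<Rightarrow> bool"
  where "direct_sum_decomp X Z \<longleftrightarrow> X \<inter> Z = {0} \<and> (\<forall>h. \<exists>x\<in>X. \<exists>z\<in>Z. h = x + z)"

definition oblique_proj :: "'a::complex_inner set \<Rightarrow> 'a set \<Rightarrow> 'a \<Rightarrow> 'a"
  where "oblique_proj X Z h = (THE x. x \<in> X \<and> (\<exists>z\<in>Z. h = x + z))"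

definition oblique_pinv ::
    "('a::complex_inner \<Rightarrow> 'b::complex_inner) \<Rightarrow> 'a set \<Rightarrow> 'b set \<Rightarrow> 'b \<Rightarrow> 'a"
  where "oblique_pinv M W V y = (THE x. x \<in> W \<and> (\<exists>z\<in>V. y = M x + z))"

text \<open>
  The Hilbert space adjoint. It is unique whenever it exists, and it exists for every bounded
  complex-linear operator between Hilbert spaces.
\<close>

definition cadjoint :: "('a::complex_inner \<Rightarrow> 'b::complex_inner) \<Rightarrow> 'b \<Rightarrow> 'a"
  where "cadjoint L = (SOME K. \<forall>x y. cinner (L x) y = cinner x (K y))"

definition bessel_in :: "'a::complex_inner set \<Rightarrow> (nat \<Rightarrow> 'a) \<Rightarrow> bool"
  where "bessel_in X F \<longleftrightarrow> range F \<subseteq> X \<and>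
    (\<exists>B>0. \<forall>h\<in>X. summable (\<lambda>n. (cmod (cinner h (F n)))\<^sup>2) \<and>
       (\<Sum>n. (cmod (cinner h (F n)))\<^sup>2) \<le> B * (norm h)\<^sup>2)"

definition frame_for :: "'a::complex_inner set \<Rightarrow> (nat \<Rightarrow> 'a) \<Rightarrow> bool"
  where "frame_for X F \<longleftrightarrow> bessel_in X F \<and>
    (\<exists>A>0. \<forall>h\<in>X. A * (norm h)\<^sup>2 \<le> (\<Sum>n. (cmod (cinner h (F n)))\<^sup>2))"

text \<open>
  The synthesis operator of a Bessel sequence is meant on square-summable sequences of
  coefficients, where the series converges; its adjoint sends h to the sequence of coefficients
  \<open>cinner h (F n)\<close>.
\<close>

definition synthesis :: "(nat \<Rightarrow> 'a::complex_inner) \<Rightarrow> (nat \<Rightarrow> complex) \<Rightarrow> 'a"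
  where "synthesis F c = (\<Sum>n. c n *\<^sub>C F n)"

definition synthesis_adj :: "(nat \<Rightarrow> 'a::complex_inner) \<Rightarrow> 'a \<Rightarrow> (nat \<Rightarrow> complex)"
  where "synthesis_adj F h = (\<lambda>n. cinner h (F n))"

text \<open>The second argument is the synthesis sequence, the third one the analysis sequence.\<close>

definition multiplier ::
    "(nat \<Rightarrow> complex) \<Rightarrow> (nat \<Rightarrow> 'b::complex_inner) \<Rightarrow> (nat \<Rightarrow> 'a::complex_inner) \<Rightarrow> 'a \<Rightarrow> 'b"
  where "multiplier m \<Phi> \<Psi> h = (\<Sum>n. (m n * cinner h (\<Psi> n)) *\<^sub>C \<Phi> n)"

definition semi_normalized :: "(nat \<Rightarrow> complex) \<Rightarrow> bool"
  where "semi_normalized m \<longleftrightarrow>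
    0 < (INF n. cmod (m n)) \<and> bdd_above (range (\<lambda>n. cmod (m n)))"

text \<open>
  F is an oblique dual frame of G on \<open>W1\<close>. The space \<open>W2\<close>, for which G is a frame, is
  an explicit parameter.
\<close>

definition oblique_dual_frame ::
    "'a::complex_inner set \<Rightarrow> 'a set \<Rightarrow> (nat \<Rightarrow> 'a) \<Rightarrow> (nat \<Rightarrow> 'a) \<Rightarrow> bool"
  where "oblique_dual_frame W1 W2 F G \<longleftrightarrow>
    closed_csubspace W1 \<and> closed_csubspace W2 \<and> direct_sum_decomp W1 (orth_compl W2) \<and>
    frame_for W1 F \<and> frame_for W2 G \<and>
    synthesis F \<circ> synthesis_adj G = oblique_proj W1 (orth_compl W2)"

end

theory Submission
  imports Defs
begin

text \<open>
  Writing \<open>S F G = synthesis F \<circ> synthesis_adj G\<close>, one has \<open>S F G\<close> adjoint to \<open>S G F\<close>, and the weights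
  \<open>1 / m\<close> cancel against those in the sequences marked \<open>s\<close>, so that all multipliers involved are of this
  form with the sequences \<open>Mp (\<Phi> n)\<close> or \<open>Mp* (\<Psi> n)\<close>. Parts (i) and (ii) arise from
  \<open>Mp = S (Mp \<Phi>) F\<close> and \<open>Mp = S G (Mp* \<Psi>)\<close> by composing with \<open>M\<close> on the left or on the right, since
  \<open>M Mp\<close> and \<open>Mp M\<close> are the oblique projections; the lower frame bounds follow from the upper bound of
  the partner sequence. The existence half of (iii) and (iv) is \<open>Mp M Mp = Mp\<close>. For uniqueness, one
  dual frame is perturbed by sequences of the form \<open>cnj (c n) *\<^sub>C v\<close> with \<open>c\<close> in the kernel of the
  synthesis operator, which isolates a single term of the series. The pseudoinverse is bounded
  by the closed graph theorem.
\<close>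

section \<open>Closed graphs, projections and functionals\<close>

text \<open>
  The Baire category half of the closed graph theorem; a closed graph then allows the approximation
  errors to be absorbed successively.
\<close>

lemma linear_almost_bounded:
  fixes T :: "'a::banach \<Rightarrow> 'b::real_normed_vector"
  assumes lin: "linear T"
  shows "\<exists>C>0. \<forall>u. \<forall>e>0. \<exists>y. norm (u - y) < e \<and> norm (T y) \<le> C * norm u"
proof -
  define S where "S n = closure {x. norm (T x) \<le> real n}" for n :: nat
  have cover: "\<Union>(range S) = UNIV"
  proof -
    have "x \<in> S (nat \<lceil>norm (T x)\<rceil>)" for x
      unfolding S_def by (rule subsetD[OF closure_subset]) (simp add: real_nat_ceiling_ge)
    then show ?thesis by blast
  qed
  have "\<exists>n. interior (S n) \<noteq> {}"
  proof (rule ccontr)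
    assume "\<not> ?thesis"
    then have "euclidean interior_of \<Union>(range S) = {}"
      by (intro Baire_category_alt) (auto simp: completely_metrizable_space_euclidean S_def)
    then show False
      using cover by simp
  qed
  then obtain n a where "a \<in> interior (S n)"
    by blast
  then obtain r where r: "r > 0" "ball a r \<subseteq> S n"
    using mem_interior by blast
  have approx: "\<exists>y. norm (u - y) < e \<and> norm (T y) \<le> real n" if "norm u < r" "e > 0" for u e
  proof -
    have "a + u \<in> S n" "a - u \<in> S n"
      using r that by (auto simp: dist_norm subset_iff)
    then obtain y z where y: "dist y (a + u) < e" "norm (T y) \<le> n"
      and z: "dist z (a - u) < e" "norm (T z) \<le> n"
      unfolding S_def closure_approachable using \<open>e > 0\<close> by blast
    \<comment> \<open>Half the difference of approximants to \<open>a + u\<close> and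
      \<open>a - u\<close> approximates \<open>u\<close>: the centre \<open>a\<close> of the ball
      cancels, and the bound \<open>n\<close> on the images survives the averaging.\<close>
    let ?w = "(1/2) *\<^sub>R (y - z)"
    have "u - ?w = (1/2) *\<^sub>R ((a + u - y) - (a - u - z))"
      by (simp add: algebra_simps) (simp flip: scaleR_add_left)
    then have "norm (u - ?w) = (1/2) * norm ((a + u - y) - (a - u - z))"
      by simp
    also have "\<dots> \<le> (1/2) * (norm (a + u - y) + norm (a - u - z))"
      by (intro mult_left_mono norm_triangle_ineq4) auto
    also have "\<dots> < e"
      using y z by (simp add: dist_norm norm_minus_commute)
    finally have 1: "norm (u - ?w) < e" .
    have "T ?w = (1/2) *\<^sub>R (T y - T z)"
      by (simp add: lin linear_diff linear_scale)
    then have "norm (T ?w) \<le> (1/2) * (norm (T y) + norm (T z))"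
      using norm_triangle_ineq4[of "T y" "T z"] by simp
    with y z 1 show ?thesis
      by (intro exI[of _ ?w]) auto
  qed
  \<comment> \<open>The factor 2 comes from rescaling \<open>u\<close> to norm \<open>r / 2\<close>,
    inside the open ball of radius \<open>r\<close>; the \<open>+ 1\<close> keeps \<open>C\<close>
    positive when \<open>n = 0\<close>.\<close>
  define C where "C = 2 * (real n + 1) / r"
  have "C > 0"
    using r by (simp add: C_def)
  moreover have "\<exists>y. norm (u - y) < e \<and> norm (T y) \<le> C * norm u" if "e > 0" for u e
  proof (cases "u = 0")
    case True
    then show ?thesis
      using that lin by (intro exI[of _ 0]) (simp add: linear_0)
  next
    case False
    define s where "s = r / (2 * norm u)"
    have s: "s > 0"
      using r False by (simp add: s_def)
    have "norm (s *\<^sub>R u) < r"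
      using r False by (simp add: s_def)
    then obtain y where y: "norm (s *\<^sub>R u - y) < s * e" "norm (T y) \<le> n"
      using approx[of "s *\<^sub>R u" "s * e"] s \<open>e > 0\<close> by auto
    have "norm (u - inverse s *\<^sub>R y) = inverse s * norm (s *\<^sub>R u - y)"
    proof -
      have "u - inverse s *\<^sub>R y = inverse s *\<^sub>R (s *\<^sub>R u - y)"
        using s by (simp add: algebra_simps)
      then show ?thesis using s by simp
    qed
    also have "\<dots> < e"
      using y s by (simp add: field_simps)
    finally have 1: "norm (u - inverse s *\<^sub>R y) < e" .
    have "norm (T (inverse s *\<^sub>R y)) = inverse s * norm (T y)"
      using s by (simp add: lin linear_scale)
    also have "\<dots> \<le> inverse s * (n + 1)"
      using y s by (intro mult_left_mono) auto
    also have "\<dots> = C * norm u"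
      using r False by (simp add: s_def C_def field_simps)
    finally show ?thesis using 1 by blast
  qed
  ultimately show ?thesis by blast
qed

theorem closed_graph_bounded_linear:
  fixes T :: "'a::banach \<Rightarrow> 'b::banach"
  assumes lin: "linear T"
    and graph: "\<And>x a y. x \<longlonglongrightarrow> a \<Longrightarrow> (\<lambda>n. T (x n)) \<longlonglongrightarrow> y \<Longrightarrow> T a = y"
  shows "bounded_linear T"
proof -
  obtain C where C: "C > 0"
    "\<And>u e. e > 0 \<Longrightarrow> \<exists>y. norm (u - y) < e \<and> norm (T y) \<le> C * norm u"
    using linear_almost_bounded[OF lin] by meson
  define Y where "Y u e = (SOME y. norm (u - y) < e \<and> norm (T y) \<le> C * norm u)" for u e
  have Y: "norm (u - Y u e) < e" "norm (T (Y u e)) \<le> C * norm u" if "e > 0" for u e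
    using someI_ex[OF C(2)[OF that, of u]] by (simp_all add: Y_def)
  have "norm (T u) \<le> norm u * (2 * C)" for u
  proof (cases "u = 0")
    case True
    then show ?thesis using lin by (simp add: linear_0)
  next
    case False
    \<comment> \<open>\<open>v k\<close> is the error left after \<open>k\<close> corrections
      \<open>y 0, y 1, ...\<close>, halved at every stage. As a correction costs at most
      \<open>C\<close> times the current error, the images \<open>T (y k)\<close> are dominated by a
      geometric series with sum \<open>2 * C * norm u\<close>. The tolerances are positive because
      \<open>u\<close> is nonzero.\<close>
    define v where "v = rec_nat u (\<lambda>k v. v - Y v (norm u * (1/2)^Suc k))"
    define y where "y k = Y (v k) (norm u * (1/2)^Suc k)" for k
    have v0: "v 0 = u" and vS: "v (Suc k) = v k - y k" for k
      by (simp_all add: v_def y_def)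
    have pos: "norm u * (1/2)^k > 0" for k :: nat
      using False by simp
    have vle: "norm (v k) \<le> norm u * (1/2)^k" for k
    proof (cases k)
      case (Suc j)
      then show ?thesis
        using Y(1)[OF pos[of "Suc j"], of "v j"] by (simp add: vS y_def)
    qed (simp add: v0)
    have Ty: "norm (T (y k)) \<le> C * norm u * (1/2)^k" for k
    proof -
      have "norm (T (y k)) \<le> C * norm (v k)"
        unfolding y_def by (rule Y(2)[OF pos])
      also have "\<dots> \<le> C * (norm u * (1/2)^k)"
        using C by (intro mult_left_mono vle) auto
      finally show ?thesis by (simp add: mult_ac)
    qed
    have geo: "(\<lambda>k. C * norm u * (1/2)^k) sums (C * norm u * 2)"
      using sums_mult[OF geometric_sums[of "1/2 :: real"], of "C * norm u"] by simp
    have summ: "summable (\<lambda>k. norm (T (y k)))"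
      by (rule summable_comparison_test'[OF sums_summable[OF geo], of 0]) (use Ty in auto)
    have partial: "(\<Sum>k<n. y k) = u - v n" for n
      by (induction n) (simp_all add: v0 vS)
    have "v \<longlonglongrightarrow> 0"
    proof (rule Lim_null_comparison)
      show "\<forall>\<^sub>F k in sequentially. norm (v k) \<le> norm u * (1/2)^k"
        using vle by simp
      show "(\<lambda>k. norm u * (1/2)^k) \<longlonglongrightarrow> 0"
        by (intro tendsto_mult_right_zero LIMSEQ_power_zero) simp
    qed
    then have "(\<lambda>n. \<Sum>k<n. y k) \<longlonglongrightarrow> u"
      unfolding partial using tendsto_diff[OF tendsto_const[of u]] by fastforce
    moreover have "(\<lambda>n. T (\<Sum>k<n. y k)) \<longlonglongrightarrow> (\<Sum>k. T (y k))"
      using summable_LIMSEQ[OF summable_norm_cancel[OF summ]] by (simp add: linear_sum[OF lin])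
    ultimately have "T u = (\<Sum>k. T (y k))"
      by (rule graph)
    also have "norm \<dots> \<le> (\<Sum>k. norm (T (y k)))"
      by (rule summable_norm[OF summ])
    also have "\<dots> \<le> (\<Sum>k. C * norm u * (1/2)^k)"
      by (intro suminf_le Ty summ sums_summable[OF geo])
    also have "\<dots> = norm u * (2 * C)"
      using sums_unique[OF geo, symmetric] by (simp add: mult_ac)
    finally show ?thesis .
  qed
  with lin show ?thesis
    by (auto simp: bounded_linear_def bounded_linear_axioms_def)
qed

section \<open>Orthogonal projection onto a closed subspace and the Riesz representation\<close>

text \<open>A sequence in \<open>S\<close> whose distances to \<open>x\<close> approach the infimum
  is Cauchy by the parallelogram law. Its limit is a nearest point, and varying that point along one
  direction of \<open>S\<close> shows the residual to be orthogonal to \<open>S\<close>.\<close>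

theorem closed_subspace_projection:
  fixes S :: "'a::{real_inner,banach} set"
  assumes sub: "subspace S" and cl: "closed S"
  shows "\<exists>p\<in>S. \<forall>s\<in>S. inner (x - p) s = 0"
proof -
  define d where "d = (INF s\<in>S. norm (x - s))"
  have ne: "S \<noteq> {}" using sub subspace_0 by blast
  have bdd: "bdd_below ((\<lambda>s. norm (x - s)) ` S)"
    by (rule bdd_belowI[of _ 0]) auto
  have dle: "d \<le> norm (x - s)" if "s \<in> S" for s
    unfolding d_def using that bdd by (rule cINF_lower[rotated])
  have d0: "d \<ge> 0"
    unfolding d_def using ne by (intro cINF_greatest) auto
  have "\<exists>s\<in>S. norm (x - s) < d + 1 / Suc n" for n
    using cINF_less_iff[OF ne bdd, of "d + 1 / Suc n"] by (simp add: d_def)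
  then obtain s where s: "\<And>n. s n \<in> S" "\<And>n. norm (x - s n) < d + 1 / Suc n"
    by metis
  \<comment> \<open>Parallelogram law for \<open>x - s i\<close> and \<open>x - s j\<close>: the
    midpoint of \<open>s i\<close> and \<open>s j\<close> lies in \<open>S\<close>, so its distance
    to \<open>x\<close> is at least \<open>d\<close>.\<close>
  have par: "(norm (s i - s j))\<^sup>2 \<le> 2 * ((norm (x - s i))\<^sup>2 - d\<^sup>2) + 2 * ((norm (x - s j))\<^sup>2 - d\<^sup>2)" for i j
  proof -
    have "(1/2) *\<^sub>R (s i + s j) \<in> S"
      using s sub by (simp add: subspace_add subspace_scale)
    then have "d \<le> norm (x - (1/2) *\<^sub>R (s i + s j))"
      by (rule dle)
    then have "d\<^sup>2 \<le> (norm (x - (1/2) *\<^sub>R (s i + s j)))\<^sup>2"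
      using d0 by simp
    then show ?thesis
      unfolding power2_norm_eq_inner by (simp add: inner_simps inner_commute algebra_simps)
  qed
  have lim: "(\<lambda>n. norm (x - s n)) \<longlonglongrightarrow> d"
  proof (rule tendsto_sandwich[where f = "\<lambda>_. d"])
    show "(\<lambda>n. d + 1 / Suc n) \<longlonglongrightarrow> d"
      using tendsto_add[OF tendsto_const[of d] LIMSEQ_inverse_real_of_nat] by (simp add: inverse_eq_divide)
  qed (use s dle in \<open>auto intro!: always_eventually less_imp_le\<close>)
  have "Cauchy s"
  proof (rule metric_CauchyI)
    fix e :: real assume "e > 0"
    have "(\<lambda>n. (norm (x - s n))\<^sup>2 - d\<^sup>2) \<longlonglongrightarrow> d\<^sup>2 - d\<^sup>2"
      by (intro tendsto_intros lim)
    then obtain N where N: "\<And>n. n \<ge> N \<Longrightarrow> \<bar>(norm (x - s n))\<^sup>2 - d\<^sup>2\<bar> < e\<^sup>2 / 4"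
      using LIMSEQ_D[of _ _ "e\<^sup>2 / 4"] \<open>e > 0\<close> by fastforce
    have "dist (s i) (s j) < e" if "i \<ge> N" "j \<ge> N" for i j
    proof -
      have *: "a < q" if "a \<le> 2 * u + 2 * v" "\<bar>u\<bar> < q / 4" "\<bar>v\<bar> < q / 4" for a q u v :: real
        using that by (simp add: abs_less_iff)
      have "(norm (s i - s j))\<^sup>2 < e\<^sup>2"
        by (rule *[OF par N[OF that(1)] N[OF that(2)]])
      then show ?thesis
        using \<open>e > 0\<close> by (simp add: dist_norm power2_less_imp_less)
    qed
    then show "\<exists>N. \<forall>i\<ge>N. \<forall>j\<ge>N. dist (s i) (s j) < e" by blast
  qed
  then obtain p where p: "s \<longlonglongrightarrow> p"
    using Cauchy_convergent convergent_def by blast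
  have pS: "p \<in> S"
    using cl s(1) p by (rule closed_sequentially)
  have "(\<lambda>n. norm (x - s n)) \<longlonglongrightarrow> norm (x - p)"
    by (intro tendsto_intros p)
  then have pd: "norm (x - p) = d"
    using lim LIMSEQ_unique by blast
  have "inner (x - p) z = 0" if z: "z \<in> S" for z
  proof (cases "z = 0")
    case False
    \<comment> \<open>The scalar that minimizes the quadratic
      \<open>norm (x - (p + t *\<^sub>R z))\<close> squared; the gain over \<open>t = 0\<close> is
      exactly the square that has to vanish.\<close>
    define t where "t = inner (x - p) z / inner z z"
    have zz: "inner z z > 0" using False by simp
    have "p + t *\<^sub>R z \<in> S"
      using pS z sub by (simp add: subspace_add subspace_scale)
    then have "(norm (x - p))\<^sup>2 \<le> (norm (x - (p + t *\<^sub>R z)))\<^sup>2"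
      using dle pd d0 by simp
    also have "\<dots> = (norm (x - p))\<^sup>2 - 2 * t * inner (x - p) z + t\<^sup>2 * inner z z"
      unfolding power2_norm_eq_inner
      by (simp add: inner_simps inner_commute algebra_simps power2_eq_square)
    also have "\<dots> = (norm (x - p))\<^sup>2 - (inner (x - p) z)\<^sup>2 / inner z z"
      using zz by (simp add: t_def power2_eq_square field_simps)
    finally have "(inner (x - p) z)\<^sup>2 / inner z z \<le> 0" by simp
    then show ?thesis
      using zz by (simp add: divide_le_0_iff)
  qed simp
  with pS show ?thesis by blast
qed

text \<open>The kernel of a nonzero functional has codimension one. Subtracting from some
  \<open>z\<close> outside the kernel its projection onto the kernel leaves a normal vector
  \<open>u\<close>, a multiple of which represents \<open>f\<close>.\<close>

theorem riesz_representation_real: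
  fixes f :: "'a::{real_inner,banach} \<Rightarrow> real"
  assumes f: "bounded_linear f"
  shows "\<exists>k. \<forall>x. f x = inner x k"
proof (cases "\<forall>x. f x = 0")
  case False
  then obtain z where z: "f z \<noteq> 0" by blast
  interpret f: bounded_linear f by (rule f)
  let ?K = "{x. f x = 0}"
  have "subspace ?K"
    by (simp add: subspace_def f.zero f.add f.scaleR)
  moreover have "closed ?K"
    by (intro closed_Collect_eq continuous_intros f.continuous_on continuous_on_id)
  ultimately obtain p where p: "f p = 0" "\<And>s. f s = 0 \<Longrightarrow> inner (z - p) s = 0"
    using closed_subspace_projection[of ?K z] by auto
  define u where "u = z - p"
  have fu: "f u \<noteq> 0"
    using z p by (simp add: u_def f.diff)
  then have uu: "inner u u \<noteq> 0"
    using f.zero by auto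
  have "f x = inner x ((f u / inner u u) *\<^sub>R u)" for x
  proof -
    \<comment> \<open>Removing the right multiple of \<open>u\<close> from \<open>x\<close> lands in
      the kernel, which is orthogonal to \<open>u\<close>.\<close>
    have "inner u (x - (f x / f u) *\<^sub>R u) = 0"
      unfolding u_def by (rule p(2)) (use fu in \<open>simp add: f.diff f.scaleR flip: u_def\<close>)
    then have "inner x u = f x / f u * inner u u"
      by (simp add: inner_simps inner_commute)
    then show ?thesis
      using fu uu by simp
  qed
  then show ?thesis by blast
qed (auto intro: exI[of _ 0])

section \<open>Adjoints\<close>

lemma cinner_add_right: "cinner x (y + z) = cinner x y + cinner x z"
  by (simp add: cinner_commute[of x] cinner_add_left)

lemma cinner_scaleC_right: "cinner x (a *\<^sub>C y) = cnj a * cinner x y"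
  by (simp add: cinner_commute[of x] cinner_scaleC_left)

lemma cinner_scaleR_left: "cinner (r *\<^sub>R x) y = complex_of_real r * cinner x y"
  by (simp flip: scaleC_of_real add: cinner_scaleC_left)

lemma cinner_scaleR_right: "cinner x (r *\<^sub>R y) = complex_of_real r * cinner x y"
  by (simp flip: scaleC_of_real add: cinner_scaleC_right)

lemma cinner_zero_left [simp]: "cinner 0 y = 0"
  using cinner_scaleR_left[of 0 0 y] by simp

lemma cinner_zero_right [simp]: "cinner x 0 = 0"
  using cinner_scaleR_right[of x 0 0] by simp

lemma cinner_diff_left: "cinner (x - y) z = cinner x z - cinner y z"
  using cinner_add_left[of "x - y" y z] by simp

lemma cinner_diff_right: "cinner x (y - z) = cinner x y - cinner x z"
  using cinner_add_right[of x "y - z" z] by simp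

lemma cinner_self_eq_0_iff [simp]: "cinner x x = 0 \<longleftrightarrow> x = 0"
  by (simp add: cinner_self)

lemma cinner_ext:
  assumes "\<And>z. cinner z x = cinner z y"
  shows "x = y"
proof -
  have "cinner (x - y) (x - y) = 0"
    using assms[of "x - y"] by (simp add: cinner_diff_right)
  then show ?thesis by simp
qed

lemma norm_scaleC: "norm (a *\<^sub>C x) = cmod a * norm x"
proof -
  have "complex_of_real ((norm (a *\<^sub>C x))\<^sup>2) = a * cnj a * complex_of_real ((norm x)\<^sup>2)"
    by (simp del: of_real_power flip: cinner_self add: cinner_scaleC_left cinner_scaleC_right)
  also have "\<dots> = complex_of_real ((cmod a * norm x)\<^sup>2)"
    by (simp only: power_mult_distrib of_real_mult complex_norm_square)
  finally have "(norm (a *\<^sub>C x))\<^sup>2 = (cmod a * norm x)\<^sup>2"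
    using of_real_eq_iff by blast
  then show ?thesis
    by (simp add: power2_eq_iff_nonneg)
qed

lemma norm_cinner_le: "cmod (cinner x y) \<le> norm x * norm y"
proof (cases "cinner x y = 0")
  case False
  \<comment> \<open>A unimodular factor that rotates \<open>cinner x y\<close> onto the positive
    real axis, so that the real Cauchy-Schwarz inequality applies to the real part.\<close>
  define a where "a = cnj (sgn (cinner x y))"
  have "cmod a = 1"
    using False by (simp add: a_def norm_sgn)
  have "a * cinner x y = complex_of_real (cmod (cinner x y))"
    using False
    by (simp add: a_def sgn_eq mult.commute flip: complex_norm_square)
      (simp add: power2_eq_square)
  then have "cmod (cinner x y) = Re (cinner (a *\<^sub>C x) y)"
    by (simp add: cinner_scaleC_left)
  also have "\<dots> \<le> norm (a *\<^sub>C x) * norm y"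
    by (simp add: Re_cinner norm_cauchy_schwarz)
  also have "\<dots> = norm x * norm y"
    by (simp add: norm_scaleC \<open>cmod a = 1\<close>)
  finally show ?thesis .
qed simp

lemma bounded_linear_cinner_left: "bounded_linear (\<lambda>x. cinner x y)"
  by (rule bounded_linear_intro[where K = "norm y"])
    (auto simp: cinner_add_left cinner_scaleR_left scaleR_conv_of_real norm_cinner_le)

lemma bounded_linear_cinner_right: "bounded_linear (\<lambda>y. cinner x y)"
  by (rule bounded_linear_intro[where K = "norm x"])
    (auto simp: cinner_add_right cinner_scaleR_right scaleR_conv_of_real mult.commute
      intro: order_trans[OF norm_cinner_le])

lemma bounded_linear_scaleC_right: "bounded_linear (\<lambda>x. a *\<^sub>C x)"
proof (rule bounded_linear_intro[where K = "cmod a"])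
  fix r :: real and x :: 'a
  show "a *\<^sub>C r *\<^sub>R x = r *\<^sub>R a *\<^sub>C x"
    by (metis mult.commute scaleC_of_real scaleC_scaleC)
qed (auto simp: scaleC_add_right norm_scaleC)

lemma Im_cinner: "Im (cinner x y) = - inner (\<i> *\<^sub>C x) y"
  using Re_cinner[of "\<i> *\<^sub>C x" y] by (simp add: cinner_scaleC_left)

text \<open>The imaginary part of the form at \<open>x\<close> is minus its real part at the
  multiple of \<open>x\<close> by the imaginary unit. Hence an adjoint for the real inner product is
  already one for the Hermitian form; this carries the real Riesz theorem over to complex
  spaces.\<close>

lemma cinner_eq_if_inner_eq:
  fixes L :: "'a::complex_inner \<Rightarrow> 'b::complex_inner"
  assumes eq: "\<And>x. inner (L x) y = inner x k"
    and hom: "\<And>x. L (\<i> *\<^sub>C x) = \<i> *\<^sub>C L x"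
  shows "cinner (L x) y = cinner x k"
proof (rule complex_eqI)
  show "Re (cinner (L x) y) = Re (cinner x k)"
    by (simp add: Re_cinner eq)
  show "Im (cinner (L x) y) = Im (cinner x k)"
    using eq[of "\<i> *\<^sub>C x"] by (simp add: Im_cinner hom)
qed

text \<open>Adjointness as a relation, so that a concrete adjoint can be exhibited and used
  directly. The relation is symmetric, composes, and forces linearity and, between Hilbert spaces,
  boundedness of both maps.\<close>

definition is_adjoint :: "('a::complex_inner \<Rightarrow> 'b::complex_inner) \<Rightarrow> ('b \<Rightarrow> 'a) \<Rightarrow> bool"
  where "is_adjoint L K \<longleftrightarrow> (\<forall>x y. cinner (L x) y = cinner x (K y))"

lemma is_adjointD: "is_adjoint L K \<Longrightarrow> cinner (L x) y = cinner x (K y)"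
  by (simp add: is_adjoint_def)

lemma is_adjointD': "is_adjoint L K \<Longrightarrow> cinner y (L x) = cinner (K y) x"
  using cinner_commute[of y "L x"] cinner_commute[of "K y" x] by (simp add: is_adjoint_def)

lemma is_adjoint_sym: "is_adjoint L K \<Longrightarrow> is_adjoint K L"
  unfolding is_adjoint_def[of K L] by (simp add: is_adjointD')

lemma is_adjoint_unique:
  assumes "is_adjoint L K" "is_adjoint L K'"
  shows "K = K'"
proof (rule ext, rule cinner_ext)
  show "cinner z (K y) = cinner z (K' y)" for y z
    using is_adjointD[OF assms(1), of z y] is_adjointD[OF assms(2), of z y] by (rule trans[OF sym])
qed

lemma is_adjoint_comp: "is_adjoint L K \<Longrightarrow> is_adjoint L' K' \<Longrightarrow> is_adjoint (L \<circ> L') (K' \<circ> K)"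
  by (simp add: is_adjoint_def)

text \<open>Uniqueness of adjoints turns the arbitrary choice in \<open>cadjoint\<close> into a rule
  for computing it.\<close>

lemma cadjoint_eqI:
  assumes "is_adjoint L K"
  shows "cadjoint L = K"
proof -
  have "\<exists>K. \<forall>x y. cinner (L x) y = cinner x (K y)"
    using assms by (auto simp: is_adjoint_def)
  then have "is_adjoint L (cadjoint L)"
    unfolding cadjoint_def is_adjoint_def by (rule someI_ex)
  with assms show ?thesis
    using is_adjoint_unique by blast
qed

lemma is_adjoint_scaleC:
  assumes "is_adjoint L K"
  shows "L (a *\<^sub>C x) = a *\<^sub>C L x"
  by (rule cinner_ext) (simp add: is_adjointD'[OF assms] cinner_scaleC_right)

lemma is_adjoint_linear:
  assumes "is_adjoint L K"
  shows "linear L"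
  by (rule linearI; rule cinner_ext)
    (simp_all add: is_adjointD'[OF assms] cinner_add_right cinner_scaleR_right)

text \<open>Hellinger--Toeplitz: the adjoint relation passes to limits, so the graph is closed.\<close>

lemma is_adjoint_bounded_linear:
  fixes L :: "'a::chilbert_space \<Rightarrow> 'b::chilbert_space"
  assumes "is_adjoint L K"
  shows "bounded_linear L"
proof (rule closed_graph_bounded_linear[OF is_adjoint_linear[OF assms]])
  fix x a y
  assume x: "x \<longlonglongrightarrow> a" "(\<lambda>n. L (x n)) \<longlonglongrightarrow> y"
  show "L a = y"
  proof (rule cinner_ext)
    fix z
    have "(\<lambda>n. cinner z (L (x n))) \<longlonglongrightarrow> cinner z y"
      by (rule bounded_linear.tendsto[OF bounded_linear_cinner_right x(2)])
    moreover have "(\<lambda>n. cinner z (L (x n))) \<longlonglongrightarrow> cinner z (L a)"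
      unfolding is_adjointD'[OF assms]
      by (rule bounded_linear.tendsto[OF bounded_linear_cinner_right x(1)])
    ultimately show "cinner z (L a) = cinner z y"
      using LIMSEQ_unique by blast
  qed
qed

lemma is_adjoint_exists:
  fixes L :: "'a::chilbert_space \<Rightarrow> 'b::chilbert_space"
  assumes bl: "bounded_linear L" and hom: "\<And>a x. L (a *\<^sub>C x) = a *\<^sub>C L x"
  shows "\<exists>K. is_adjoint L K"
proof -
  have "\<exists>k. \<forall>x. inner (L x) y = inner x k" for y
    by (intro riesz_representation_real bounded_linear_compose[OF bounded_linear_inner_left bl])
  then obtain K where "\<And>x y. inner (L x) y = inner x (K y)"
    by metis
  then have "is_adjoint L K"
    by (simp add: is_adjoint_def cinner_eq_if_inner_eq hom)
  then show ?thesis by blast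
qed

section \<open>Closed complex subspaces and their orthogonal projections\<close>

lemma closed_csubspaceD:
  assumes "closed_csubspace X"
  shows "subspace X" "closed X" "0 \<in> X" "x \<in> X \<Longrightarrow> y \<in> X \<Longrightarrow> x + y \<in> X"
    "x \<in> X \<Longrightarrow> y \<in> X \<Longrightarrow> x - y \<in> X" "x \<in> X \<Longrightarrow> a *\<^sub>C x \<in> X"
proof -
  have X: "complex_vector.subspace X" "closed X"
    using assms by (simp_all add: closed_csubspace_def)
  show "closed X" "0 \<in> X" "x \<in> X \<Longrightarrow> y \<in> X \<Longrightarrow> x + y \<in> X"
    "x \<in> X \<Longrightarrow> y \<in> X \<Longrightarrow> x - y \<in> X" "x \<in> X \<Longrightarrow> a *\<^sub>C x \<in> X"
    by (fact X complex_vector.subspace_0[OF X(1)] complex_vector.subspace_add[OF X(1)]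
        complex_vector.subspace_diff[OF X(1)] complex_vector.subspace_scale[OF X(1)])+
  have "r *\<^sub>R x \<in> X" if "x \<in> X" for r x
    unfolding scaleC_of_real[symmetric] using that by (rule complex_vector.subspace_scale[OF X(1)])
  then show "subspace X"
    using complex_vector.subspace_0[OF X(1)] complex_vector.subspace_add[OF X(1)]
    by (simp add: subspace_def)
qed

lemma closed_csubspace_orth_compl: "closed_csubspace (orth_compl X)"
proof -
  have "orth_compl X = (\<Inter>x\<in>X. {h. cinner h x = 0})"
    by (auto simp: orth_compl_def)
  moreover have "closed {h. cinner h x = 0}" for x :: 'a
    by (intro closed_Collect_eq continuous_intros)
      (simp_all add: linear_continuous_on bounded_linear_cinner_left)
  ultimately have "closed (orth_compl X)"
    by auto
  then show ?thesis
    by (auto simp: closed_csubspace_def complex_vector.subspace_def orth_compl_def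
      cinner_add_left cinner_scaleC_left)
qed

text \<open>The real projection suffices: a complex subspace contains the multiple of
  \<open>s\<close> by the imaginary unit, and real orthogonality to that vector kills the imaginary
  part of the form.\<close>

lemma orthogonal_projection_exists:
  fixes X :: "'a::chilbert_space set"
  assumes X: "closed_csubspace X"
  shows "\<exists>p\<in>X. norm p \<le> norm x \<and> (\<forall>s\<in>X. cinner x s = cinner p s)"
proof -
  obtain p where p: "p \<in> X" "\<And>s. s \<in> X \<Longrightarrow> inner (x - p) s = 0"
    using closed_subspace_projection[OF closed_csubspaceD(1,2)[OF X], of x] by blast
  have "cinner (x - p) s = 0" if "s \<in> X" for s
  proof (rule complex_eqI)
    show "Re (cinner (x - p) s) = Re 0"
      using p that by (simp add: Re_cinner)
    have "Re (cinner (x - p) (\<i> *\<^sub>C s)) = 0"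
      using p closed_csubspaceD(6)[OF X that] by (simp add: Re_cinner)
    then show "Im (cinner (x - p) s) = Im 0"
      by (simp add: cinner_scaleC_right)
  qed
  moreover have "norm p \<le> norm x"
  proof (rule power2_le_imp_le)
    have "inner (x - p) p = 0"
      using p by blast
    then have "(norm x)\<^sup>2 = (norm (x - p))\<^sup>2 + (norm p)\<^sup>2"
      unfolding power2_norm_eq_inner by (simp add: inner_simps inner_commute)
    then show "(norm p)\<^sup>2 \<le> (norm x)\<^sup>2"
      by simp
  qed simp
  ultimately show ?thesis
    using p(1) by (auto simp: cinner_diff_left)
qed

section \<open>Bessel sequences\<close>

lemma besselE:
  assumes "bessel_in UNIV F"
  obtains B where "B > 0"
    "\<And>h. summable (\<lambda>n. (cmod (cinner h (F n)))\<^sup>2)"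
    "\<And>h. (\<Sum>n. (cmod (cinner h (F n)))\<^sup>2) \<le> B * (norm h)\<^sup>2"
  using assms by (auto simp: bessel_in_def)

lemma besselI:
  assumes "\<And>h. summable (\<lambda>n. (cmod (cinner h (F n)))\<^sup>2)"
    "\<And>h. (\<Sum>n. (cmod (cinner h (F n)))\<^sup>2) \<le> B * (norm h)\<^sup>2"
  shows "bessel_in UNIV F"
proof -
  \<comment> \<open>\<open>bessel_in\<close> demands a positive constant while \<open>B\<close> is
    an arbitrary real; hence \<open>max B 1\<close>.\<close>
  have "(\<Sum>n. (cmod (cinner h (F n)))\<^sup>2) \<le> max B 1 * (norm h)\<^sup>2" for h
    by (rule order_trans[OF assms(2) mult_right_mono]) auto
  then show ?thesis
    using assms(1) by (auto simp: bessel_in_def intro!: exI[of _ "max B 1"])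
qed

text \<open>Coefficients against vectors of \<open>X\<close> see only the orthogonal projection of
  \<open>h\<close> onto \<open>X\<close>, which does not increase the norm, so the bound on
  \<open>X\<close> holds everywhere. Later arguments can therefore work with
  \<open>bessel_in UNIV\<close> and treat the range separately.\<close>

lemma bessel_in_iff:
  fixes X :: "'a::chilbert_space set"
  assumes X: "closed_csubspace X"
  shows "bessel_in X F \<longleftrightarrow> range F \<subseteq> X \<and> bessel_in UNIV F"
proof
  assume L: "bessel_in X F"
  then obtain B where B: "range F \<subseteq> X" "B > 0"
    "\<And>h. h \<in> X \<Longrightarrow> summable (\<lambda>n. (cmod (cinner h (F n)))\<^sup>2)"
    "\<And>h. h \<in> X \<Longrightarrow> (\<Sum>n. (cmod (cinner h (F n)))\<^sup>2) \<le> B * (norm h)\<^sup>2"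
    by (auto simp: bessel_in_def)
  have "summable (\<lambda>n. (cmod (cinner h (F n)))\<^sup>2) \<and>
      (\<Sum>n. (cmod (cinner h (F n)))\<^sup>2) \<le> B * (norm h)\<^sup>2" for h
  proof -
    obtain p where p: "p \<in> X" "norm p \<le> norm h" "\<And>s. s \<in> X \<Longrightarrow> cinner h s = cinner p s"
      using orthogonal_projection_exists[OF X, of h] by blast
    have "cinner h (F n) = cinner p (F n)" for n
      using p(3) B(1) by auto
    moreover have "B * (norm p)\<^sup>2 \<le> B * (norm h)\<^sup>2"
      using p(2) B(2) by simp
    ultimately show ?thesis
      using B(3,4)[OF p(1)] by simp
  qed
  then show "range F \<subseteq> X \<and> bessel_in UNIV F"
    using B(1) by (auto intro: besselI)
qed (auto simp: bessel_in_def)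

text \<open>Moving \<open>K\<close> across the form turns the new coefficients of \<open>h\<close>
  into the old ones of \<open>L h\<close>; \<open>L\<close> is bounded because it has an
  adjoint.\<close>

lemma bessel_image:
  fixes F :: "nat \<Rightarrow> 'b::chilbert_space" and K :: "'b \<Rightarrow> 'a::chilbert_space"
  assumes F: "bessel_in UNIV F" and adj: "is_adjoint K L"
  shows "bessel_in UNIV (\<lambda>n. K (F n))"
proof -
  obtain B where B: "B > 0" "\<And>h. summable (\<lambda>n. (cmod (cinner h (F n)))\<^sup>2)"
    "\<And>h. (\<Sum>n. (cmod (cinner h (F n)))\<^sup>2) \<le> B * (norm h)\<^sup>2"
    using besselE[OF F] by metis
  obtain C where C: "\<And>h. norm (L h) \<le> norm h * C"
    using bounded_linear.bounded[OF is_adjoint_bounded_linear[OF is_adjoint_sym[OF adj]]] by blast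
  have eq: "cinner h (K (F n)) = cinner (L h) (F n)" for h n
    by (rule is_adjointD'[OF adj])
  show ?thesis
  proof (rule besselI)
    fix h
    show "summable (\<lambda>n. (cmod (cinner h (K (F n))))\<^sup>2)"
      unfolding eq by (rule B)
    have "(norm (L h))\<^sup>2 \<le> (norm h * C)\<^sup>2"
      using C by (simp add: power_mono)
    then have "B * (norm (L h))\<^sup>2 \<le> B * C\<^sup>2 * (norm h)\<^sup>2"
      using B(1) by (simp add: power_mult_distrib mult_ac)
    with B(3)[of "L h"] show "(\<Sum>n. (cmod (cinner h (K (F n))))\<^sup>2) \<le> B * C\<^sup>2 * (norm h)\<^sup>2"
      unfolding eq by linarith
  qed
qed

lemma bessel_weighted:
  fixes F :: "nat \<Rightarrow> 'a::complex_inner"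
  assumes F: "bessel_in UNIV F" and w: "\<And>n. cmod (w n) \<le> C"
  shows "bessel_in UNIV (\<lambda>n. w n *\<^sub>C F n)"
proof -
  obtain B where B: "\<And>h. summable (\<lambda>n. (cmod (cinner h (F n)))\<^sup>2)"
    "\<And>h. (\<Sum>n. (cmod (cinner h (F n)))\<^sup>2) \<le> B * (norm h)\<^sup>2"
    using besselE[OF F] by metis
  have le: "(cmod (cinner h (w n *\<^sub>C F n)))\<^sup>2 \<le> C\<^sup>2 * (cmod (cinner h (F n)))\<^sup>2" for h n
    using w[of n] by (simp add: cinner_scaleC_right norm_mult power_mult_distrib mult_right_mono power_mono)
  have summ: "summable (\<lambda>n. (cmod (cinner h (w n *\<^sub>C F n)))\<^sup>2)" for h
    by (rule summable_comparison_test'[OF summable_mult[OF B(1)[of h], of "C\<^sup>2"], of 0])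
      (use le in auto)
  show ?thesis
  proof (rule besselI)
    fix h
    have "(\<Sum>n. (cmod (cinner h (w n *\<^sub>C F n)))\<^sup>2) \<le> (\<Sum>n. C\<^sup>2 * (cmod (cinner h (F n)))\<^sup>2)"
      by (intro suminf_le le summ summable_mult B)
    also have "\<dots> = C\<^sup>2 * (\<Sum>n. (cmod (cinner h (F n)))\<^sup>2)"
      by (rule suminf_mult[OF B(1)])
    also have "\<dots> \<le> C\<^sup>2 * B * (norm h)\<^sup>2"
      using mult_left_mono[OF B(2), of "C\<^sup>2"] by (simp add: mult.assoc)
    finally show "(\<Sum>n. (cmod (cinner h (w n *\<^sub>C F n)))\<^sup>2) \<le> C\<^sup>2 * B * (norm h)\<^sup>2" .
  qed (rule summ)
qed

lemma cmod_add_squared_le: "(cmod (a + b))\<^sup>2 \<le> 2 * (cmod a)\<^sup>2 + 2 * (cmod b)\<^sup>2"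
proof -
  have "(cmod (a + b))\<^sup>2 \<le> (cmod a + cmod b)\<^sup>2"
    by (intro power_mono norm_triangle_ineq) auto
  also have "\<dots> \<le> 2 * (cmod a)\<^sup>2 + 2 * (cmod b)\<^sup>2"
    using zero_le_power2[of "cmod a - cmod b"] by (simp add: power2_eq_square algebra_simps)
  finally show ?thesis .
qed

lemma bessel_add:
  fixes F G :: "nat \<Rightarrow> 'a::complex_inner"
  assumes F: "bessel_in UNIV F" and G: "bessel_in UNIV G"
  shows "bessel_in UNIV (\<lambda>n. F n + G n)"
proof -
  obtain B where B: "\<And>h. summable (\<lambda>n. (cmod (cinner h (F n)))\<^sup>2)"
    "\<And>h. (\<Sum>n. (cmod (cinner h (F n)))\<^sup>2) \<le> B * (norm h)\<^sup>2"
    using besselE[OF F] by metis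
  obtain C where C: "\<And>h. summable (\<lambda>n. (cmod (cinner h (G n)))\<^sup>2)"
    "\<And>h. (\<Sum>n. (cmod (cinner h (G n)))\<^sup>2) \<le> C * (norm h)\<^sup>2"
    using besselE[OF G] by metis
  have le: "(cmod (cinner h (F n + G n)))\<^sup>2
      \<le> 2 * (cmod (cinner h (F n)))\<^sup>2 + 2 * (cmod (cinner h (G n)))\<^sup>2" for h n
    by (simp add: cinner_add_right cmod_add_squared_le)
  have summ': "summable (\<lambda>n. 2 * (cmod (cinner h (F n)))\<^sup>2 + 2 * (cmod (cinner h (G n)))\<^sup>2)" for h
    by (intro summable_add summable_mult B C)
  have summ: "summable (\<lambda>n. (cmod (cinner h (F n + G n)))\<^sup>2)" for h
    by (rule summable_comparison_test'[OF summ'[of h], of 0]) (use le in auto)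
  show ?thesis
  proof (rule besselI)
    fix h
    have "(\<Sum>n. (cmod (cinner h (F n + G n)))\<^sup>2)
        \<le> (\<Sum>n. 2 * (cmod (cinner h (F n)))\<^sup>2 + 2 * (cmod (cinner h (G n)))\<^sup>2)"
      by (intro suminf_le le summ summ')
    also have "\<dots> = 2 * (\<Sum>n. (cmod (cinner h (F n)))\<^sup>2) + 2 * (\<Sum>n. (cmod (cinner h (G n)))\<^sup>2)"
      by (subst suminf_add[symmetric]) (auto intro: summable_mult B C simp: suminf_mult B C)
    also have "\<dots> \<le> (2 * B + 2 * C) * (norm h)\<^sup>2"
      using B(2)[of h] C(2)[of h] by (simp add: algebra_simps)
    finally show "(\<Sum>n. (cmod (cinner h (F n + G n)))\<^sup>2) \<le> (2 * B + 2 * C) * (norm h)\<^sup>2" .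
  qed (rule summ)
qed

text \<open>Sequences on a single line serve as perturbations of dual frames in the uniqueness
  argument.\<close>

lemma bessel_rank_one:
  assumes c: "summable (\<lambda>n. (cmod (c n))\<^sup>2)"
  shows "bessel_in UNIV (\<lambda>n. c n *\<^sub>C v)"
proof -
  have eq: "(cmod (cinner h (c n *\<^sub>C v)))\<^sup>2 = (cmod (cinner h v))\<^sup>2 * (cmod (c n))\<^sup>2" for h n
    by (simp add: cinner_scaleC_right norm_mult power_mult_distrib)
  show ?thesis
  proof (rule besselI)
    fix h
    show "summable (\<lambda>n. (cmod (cinner h (c n *\<^sub>C v)))\<^sup>2)"
      unfolding eq by (intro summable_mult c)
    have "(cmod (cinner h v))\<^sup>2 \<le> (norm h * norm v)\<^sup>2"
      by (intro power_mono norm_cinner_le) auto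
    then have "(cmod (cinner h v))\<^sup>2 * (\<Sum>n. (cmod (c n))\<^sup>2)
        \<le> (norm h * norm v)\<^sup>2 * (\<Sum>n. (cmod (c n))\<^sup>2)"
      by (intro mult_right_mono suminf_nonneg c) auto
    then show "(\<Sum>n. (cmod (cinner h (c n *\<^sub>C v)))\<^sup>2)
        \<le> ((norm v)\<^sup>2 * (\<Sum>n. (cmod (c n))\<^sup>2)) * (norm h)\<^sup>2"
      unfolding eq suminf_mult[OF c] by (simp add: power_mult_distrib mult_ac)
  qed
qed

section \<open>Synthesis of square-summable coefficients\<close>

text \<open>The finite form of the fact that synthesis and analysis have the same norm. Pairing the
  sum \<open>s\<close> with itself and applying Cauchy-Schwarz bounds the fourth power of
  \<open>norm s\<close> by the coefficient sum times \<open>B\<close> times the square of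
  \<open>norm s\<close>, which cancels.\<close>

lemma norm_synthesis_sum_le:
  fixes F :: "nat \<Rightarrow> 'a::complex_inner"
  assumes B: "B \<ge> 0" "\<And>h. summable (\<lambda>n. (cmod (cinner h (F n)))\<^sup>2)"
    "\<And>h. (\<Sum>n. (cmod (cinner h (F n)))\<^sup>2) \<le> B * (norm h)\<^sup>2" and A: "finite A"
  shows "(norm (\<Sum>n\<in>A. c n *\<^sub>C F n))\<^sup>2 \<le> B * (\<Sum>n\<in>A. (cmod (c n))\<^sup>2)"
proof (cases "(\<Sum>n\<in>A. c n *\<^sub>C F n) = 0")
  case True
  then show ?thesis using B(1) by (simp add: sum_nonneg)
next
  case False
  define s where "s = (\<Sum>n\<in>A. c n *\<^sub>C F n)"
  have s: "norm s > 0" using False by (simp add: s_def)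
  have "cinner s s = (\<Sum>n\<in>A. cnj (c n) * cinner s (F n))"
    by (subst (2) s_def)
      (simp add: linear_sum[OF bounded_linear.linear[OF bounded_linear_cinner_right]] cinner_scaleC_right)
  then have "(norm s)\<^sup>2 = cmod (\<Sum>n\<in>A. cnj (c n) * cinner s (F n))"
    by (metis cinner_self norm_of_real abs_power2 real_norm_def)
  also have "\<dots> \<le> (\<Sum>n\<in>A. cmod (c n) * cmod (cinner s (F n)))"
    by (rule order_trans[OF norm_sum]) (simp add: norm_mult)
  also have "\<dots> \<le> L2_set (\<lambda>n. cmod (c n)) A * L2_set (\<lambda>n. cmod (cinner s (F n))) A"
    using L2_set_mult_ineq[of "\<lambda>n. cmod (c n)" "\<lambda>n. cmod (cinner s (F n))" A] by simp
  finally have "((norm s)\<^sup>2)\<^sup>2 \<le> (L2_set (\<lambda>n. cmod (c n)) A * L2_set (\<lambda>n. cmod (cinner s (F n))) A)\<^sup>2"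
    by (intro power_mono) auto
  also have "\<dots> = (\<Sum>n\<in>A. (cmod (c n))\<^sup>2) * (\<Sum>n\<in>A. (cmod (cinner s (F n)))\<^sup>2)"
    by (simp add: L2_set_def power_mult_distrib sum_nonneg)
  also have "\<dots> \<le> (\<Sum>n\<in>A. (cmod (c n))\<^sup>2) * (B * (norm s)\<^sup>2)"
    by (intro mult_left_mono order_trans[OF sum_le_suminf[OF B(2) A] B(3)] sum_nonneg) auto
  finally have "(norm s)\<^sup>2 * (norm s)\<^sup>2 \<le> (B * (\<Sum>n\<in>A. (cmod (c n))\<^sup>2)) * (norm s)\<^sup>2"
    by (simp add: power2_eq_square mult_ac)
  then have "(norm s)\<^sup>2 \<le> B * (\<Sum>n\<in>A. (cmod (c n))\<^sup>2)"
    by (rule mult_right_le_imp_le) (use s in simp)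
  then show ?thesis
    by (simp add: s_def)
qed

text \<open>The finite estimate bounds blocks of the series by blocks of the convergent series of
  squared coefficients, so the Cauchy criterion transfers.\<close>

lemma summable_synthesis:
  fixes F :: "nat \<Rightarrow> 'a::chilbert_space"
  assumes F: "bessel_in UNIV F" and c: "summable (\<lambda>n. (cmod (c n))\<^sup>2)"
  shows "summable (\<lambda>n. c n *\<^sub>C F n)"
  unfolding summable_Cauchy
proof (intro allI impI)
  fix e :: real assume e: "e > 0"
  obtain B where B: "B > 0" "\<And>h. summable (\<lambda>n. (cmod (cinner h (F n)))\<^sup>2)"
    "\<And>h. (\<Sum>n. (cmod (cinner h (F n)))\<^sup>2) \<le> B * (norm h)\<^sup>2"
    using besselE[OF F] by metis
  have "e\<^sup>2 / B > 0" using e B by simp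
  then obtain N where N: "\<And>k n. k \<ge> N \<Longrightarrow> norm (\<Sum>i=k..<n. (cmod (c i))\<^sup>2) < e\<^sup>2 / B"
    using c unfolding summable_Cauchy by blast
  have "norm (\<Sum>i=k..<n. c i *\<^sub>C F i) < e" if "k \<ge> N" for k n
  proof -
    have "(norm (\<Sum>i=k..<n. c i *\<^sub>C F i))\<^sup>2 \<le> B * (\<Sum>i=k..<n. (cmod (c i))\<^sup>2)"
      using B by (intro norm_synthesis_sum_le) auto
    also have "\<dots> < e\<^sup>2"
      using N[OF that, of n] B(1) by (simp add: sum_nonneg field_simps)
    finally show ?thesis
      using e by (simp add: power2_less_imp_less)
  qed
  then show "\<exists>N. \<forall>k\<ge>N. \<forall>n. norm (\<Sum>i=k..<n. c i *\<^sub>C F i) < e" by blast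
qed

lemma norm_synthesis_le:
  fixes F :: "nat \<Rightarrow> 'a::chilbert_space"
  assumes F: "bessel_in UNIV F"
  shows "\<exists>B>0. \<forall>c. summable (\<lambda>n. (cmod (c n))\<^sup>2) \<longrightarrow>
    (norm (synthesis F c))\<^sup>2 \<le> B * (\<Sum>n. (cmod (c n))\<^sup>2)"
proof -
  obtain B where B: "B > 0" "\<And>h. summable (\<lambda>n. (cmod (cinner h (F n)))\<^sup>2)"
    "\<And>h. (\<Sum>n. (cmod (cinner h (F n)))\<^sup>2) \<le> B * (norm h)\<^sup>2"
    using besselE[OF F] by metis
  have "(norm (synthesis F c))\<^sup>2 \<le> B * (\<Sum>n. (cmod (c n))\<^sup>2)"
    if c: "summable (\<lambda>n. (cmod (c n))\<^sup>2)" for c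
  proof (rule LIMSEQ_le)
    show "(\<lambda>N. (norm (\<Sum>n<N. c n *\<^sub>C F n))\<^sup>2) \<longlonglongrightarrow> (norm (synthesis F c))\<^sup>2"
      unfolding synthesis_def by (intro tendsto_intros summable_LIMSEQ summable_synthesis F c)
    show "(\<lambda>N. B * (\<Sum>n<N. (cmod (c n))\<^sup>2)) \<longlonglongrightarrow> B * (\<Sum>n. (cmod (c n))\<^sup>2)"
      by (intro tendsto_intros summable_LIMSEQ c)
    show "\<exists>K. \<forall>N\<ge>K. (norm (\<Sum>n<N. c n *\<^sub>C F n))\<^sup>2 \<le> B * (\<Sum>n<N. (cmod (c n))\<^sup>2)"
      using norm_synthesis_sum_le[OF less_imp_le[OF B(1)] B(2,3)] by blast
  qed
  with B(1) show ?thesis by blast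
qed

lemma summable_cinner_squared:
  "bessel_in UNIV F \<Longrightarrow> summable (\<lambda>n. (cmod (cinner h (F n)))\<^sup>2)"
  by (rule besselE)

lemma synthesis_diff:
  fixes F :: "nat \<Rightarrow> 'a::chilbert_space"
  assumes "bessel_in UNIV F" "summable (\<lambda>n. (cmod (c n))\<^sup>2)" "summable (\<lambda>n. (cmod (d n))\<^sup>2)"
  shows "synthesis F (\<lambda>n. c n - d n) = synthesis F c - synthesis F d"
  unfolding synthesis_def complex_vector.scale_left_diff_distrib
  by (intro suminf_diff[symmetric] summable_synthesis assms)

lemma synthesis_add:
  fixes F :: "nat \<Rightarrow> 'a::chilbert_space"
  assumes "bessel_in UNIV F" "summable (\<lambda>n. (cmod (c n))\<^sup>2)" "summable (\<lambda>n. (cmod (d n))\<^sup>2)"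
  shows "synthesis F (\<lambda>n. c n + d n) = synthesis F c + synthesis F d"
  unfolding synthesis_def scaleC_add_left
  by (intro suminf_add[symmetric] summable_synthesis assms)

lemma synthesis_scale:
  fixes F :: "nat \<Rightarrow> 'a::chilbert_space"
  assumes "bessel_in UNIV F" "summable (\<lambda>n. (cmod (c n))\<^sup>2)"
  shows "synthesis F (\<lambda>n. a * c n) = a *\<^sub>C synthesis F c"
  unfolding synthesis_def scaleC_scaleC[symmetric]
  by (intro bounded_linear.suminf[OF bounded_linear_scaleC_right, symmetric] summable_synthesis assms)

lemma synthesis_unit: "synthesis F (\<lambda>n. if n = k then 1 else 0) = F k"
proof -
  have "(\<lambda>n. (if n = k then 1 else 0) *\<^sub>C F n) = (\<lambda>n. if n = k then F n else 0)"
    by auto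
  then show ?thesis
    unfolding synthesis_def using sums_unique[OF sums_single[of k F]] by simp
qed

section \<open>Mixed frame operators, their adjoints, and multipliers\<close>

text \<open>The operator called \<open>S F G\<close> in the overview: synthesis along
  \<open>F\<close> after analysis along \<open>G\<close>. It is the common form of the multipliers
  and of the operator in the definition of oblique duals.\<close>

definition mixed_frame_op ::
    "(nat \<Rightarrow> 'b::complex_inner) \<Rightarrow> (nat \<Rightarrow> 'a::complex_inner) \<Rightarrow> 'a \<Rightarrow> 'b"
  where "mixed_frame_op F G = synthesis F \<circ> synthesis_adj G"

lemma mixed_frame_op_apply: "mixed_frame_op F G h = (\<Sum>n. cinner h (G n) *\<^sub>C F n)"
  by (simp add: mixed_frame_op_def synthesis_def synthesis_adj_def)

lemma summable_mixed_frame_op: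
  fixes F :: "nat \<Rightarrow> 'a::chilbert_space"
  assumes "bessel_in UNIV F" "bessel_in UNIV G"
  shows "summable (\<lambda>n. cinner h (G n) *\<^sub>C F n)"
  by (intro summable_synthesis summable_cinner_squared assms)

lemma is_adjoint_mixed_frame_op:
  fixes F :: "nat \<Rightarrow> 'b::chilbert_space" and G :: "nat \<Rightarrow> 'a::chilbert_space"
  assumes F: "bessel_in UNIV F" and G: "bessel_in UNIV G"
  shows "is_adjoint (mixed_frame_op F G) (mixed_frame_op G F)"
  unfolding is_adjoint_def
proof (intro allI)
  fix x y
  have "cinner (mixed_frame_op F G x) y = (\<Sum>n. cinner (cinner x (G n) *\<^sub>C F n) y)"
    unfolding mixed_frame_op_apply
    by (rule bounded_linear.suminf[OF bounded_linear_cinner_left])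
      (rule summable_mixed_frame_op[OF F G])
  also have "\<dots> = (\<Sum>n. cinner x (cinner y (F n) *\<^sub>C G n))"
    by (simp add: cinner_scaleC_left cinner_scaleC_right mult.commute flip: cinner_commute)
  also have "\<dots> = cinner x (mixed_frame_op G F y)"
    unfolding mixed_frame_op_apply
    by (rule bounded_linear.suminf[OF bounded_linear_cinner_right, symmetric])
      (rule summable_mixed_frame_op[OF G F])
  finally show "cinner (mixed_frame_op F G x) y = cinner x (mixed_frame_op G F y)" .
qed

lemma mixed_frame_op_image_left:
  fixes F :: "nat \<Rightarrow> 'b::chilbert_space" and L :: "'b \<Rightarrow> 'c::chilbert_space"
  assumes L: "is_adjoint L K" and "bessel_in UNIV F" "bessel_in UNIV G"
  shows "L (mixed_frame_op F G h) = mixed_frame_op (\<lambda>n. L (F n)) G h"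
  unfolding mixed_frame_op_apply is_adjoint_scaleC[OF L, symmetric]
  by (rule bounded_linear.suminf[OF is_adjoint_bounded_linear[OF L]])
    (rule summable_mixed_frame_op[OF assms(2,3)])

lemma mixed_frame_op_image_right:
  assumes "is_adjoint L K"
  shows "mixed_frame_op F G (L h) = mixed_frame_op F (\<lambda>n. K (G n)) h"
  by (simp add: mixed_frame_op_apply is_adjointD[OF assms])

lemma multiplier_eq_weight_left: "multiplier m \<Phi> \<Psi> = mixed_frame_op (\<lambda>n. m n *\<^sub>C \<Phi> n) \<Psi>"
  by (rule ext) (simp add: multiplier_def mixed_frame_op_apply scaleC_scaleC mult.commute)

text \<open>On the analysis side the weight is conjugated, since the form is conjugate-linear in its
  second argument. This variant fits \<open>\<Phi>s\<close>, which carries conjugated weights; the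
  previous one fits \<open>\<Psi>s\<close>.\<close>

lemma multiplier_eq_weight_right:
  "multiplier m \<Phi> \<Psi> = mixed_frame_op \<Phi> (\<lambda>n. cnj (m n) *\<^sub>C \<Psi> n)"
  by (rule ext) (simp add: multiplier_def mixed_frame_op_apply cinner_scaleC_right)

text \<open>Cauchy-Schwarz gives \<open>norm h \<le> norm (mixed_frame_op G F h)\<close>, and
  boundedness of synthesis along \<open>G\<close> turns this into a lower frame bound for
  \<open>F\<close>. Only the quadratic form is prescribed, because for an oblique pair the mixed
  operator in the required order need not fix the vectors of \<open>X\<close>.\<close>

lemma frame_forI:
  fixes F G :: "nat \<Rightarrow> 'a::chilbert_space"
  assumes X: "closed_csubspace X" "range F \<subseteq> X"
    and bes: "bessel_in UNIV F" "bessel_in UNIV G"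
    and rep: "\<And>h. h \<in> X \<Longrightarrow> cinner (mixed_frame_op G F h) h = cinner h h"
  shows "frame_for X F"
proof -
  obtain B where B: "B > 0" "\<And>c. summable (\<lambda>n. (cmod (c n))\<^sup>2) \<Longrightarrow>
      (norm (synthesis G c))\<^sup>2 \<le> B * (\<Sum>n. (cmod (c n))\<^sup>2)"
    using norm_synthesis_le[OF bes(2)] by blast
  have "inverse B * (norm h)\<^sup>2 \<le> (\<Sum>n. (cmod (cinner h (F n)))\<^sup>2)" if h: "h \<in> X" for h
  proof (cases "h = 0")
    case False
    have "norm h * norm h = cmod (cinner (mixed_frame_op G F h) h)"
      by (simp add: rep[OF h] cinner_self norm_power power2_eq_square norm_mult)
    also have "\<dots> \<le> norm (mixed_frame_op G F h) * norm h"
      by (rule norm_cinner_le)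
    finally have "norm h \<le> norm (mixed_frame_op G F h)"
      using False by simp
    then have "(norm h)\<^sup>2 \<le> (norm (mixed_frame_op G F h))\<^sup>2"
      by (simp add: power_mono)
    also have "\<dots> \<le> B * (\<Sum>n. (cmod (cinner h (F n)))\<^sup>2)"
      unfolding mixed_frame_op_def synthesis_adj_def comp_apply
      by (intro B summable_cinner_squared bes)
    finally show ?thesis
      using B(1) by (simp add: field_simps)
  qed (simp)
  moreover have "bessel_in X F"
    using X bes(1) bessel_in_iff by blast
  ultimately show ?thesis
    unfolding frame_for_def using B(1) positive_imp_inverse_positive by blast
qed

section \<open>Oblique projections and oblique dual frames\<close>

lemma direct_sum_unique:
  assumes "direct_sum_decomp X Z" "complex_vector.subspace X" "complex_vector.subspace Z"
    and "x \<in> X" "z \<in> Z" "x' \<in> X" "z' \<in> Z" "x + z = x' + z'"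
  shows "x = x'" "z = z'"
proof -
  have "x - x' = z' - z"
    using assms(8) by (simp add: algebra_simps)
  then have "x - x' \<in> X \<inter> Z"
    using assms complex_vector.subspace_diff by (metis IntI)
  then have "x - x' = 0"
    using assms(1) unfolding direct_sum_decomp_def by blast
  then show "x = x'" "z = z'"
    using assms(8) by simp_all
qed

lemma direct_sumE:
  assumes "direct_sum_decomp X Z"
  obtains x z where "x \<in> X" "z \<in> Z" "h = x + z"
  using assms unfolding direct_sum_decomp_def by blast

lemma oblique_proj_eqI:
  assumes "direct_sum_decomp X Z" "complex_vector.subspace X" "complex_vector.subspace Z"
    and "x \<in> X" "h - x \<in> Z"
  shows "oblique_proj X Z h = x"
  unfolding oblique_proj_def
proof (rule the_equality)
  show "x \<in> X \<and> (\<exists>z\<in>Z. h = x + z)"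
    using assms(4,5) by (intro conjI bexI[of _ "h - x"]) auto
next
  fix x' assume "x' \<in> X \<and> (\<exists>z\<in>Z. h = x' + z)"
  then obtain z where z: "x' \<in> X" "z \<in> Z" "h = x' + z"
    by blast
  show "x' = x"
    by (rule direct_sum_unique(1)[OF assms(1-3) z(1,2) assms(4,5)]) (simp add: z(3))
qed

lemma oblique_proj_mem:
  assumes "direct_sum_decomp X Z" "complex_vector.subspace X" "complex_vector.subspace Z"
  shows "oblique_proj X Z h \<in> X" "h - oblique_proj X Z h \<in> Z"
proof -
  obtain x z where "x \<in> X" "z \<in> Z" "h = x + z"
    using direct_sumE[OF assms(1)] by blast
  moreover from this have "oblique_proj X Z h = x"
    by (intro oblique_proj_eqI[OF assms]) auto
  ultimately show "oblique_proj X Z h \<in> X" "h - oblique_proj X Z h \<in> Z"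
    by auto
qed

lemma oblique_proj_eq_self:
  assumes "direct_sum_decomp X Z" "complex_vector.subspace X" "complex_vector.subspace Z" "h \<in> X"
  shows "oblique_proj X Z h = h"
  using assms by (intro oblique_proj_eqI) (auto intro: complex_vector.subspace_0)

text \<open>The adjoint \<open>E\<close> maps into \<open>orth_compl Z\<close> because the
  projection annihilates \<open>Z\<close>, and \<open>h - E h\<close> is orthogonal to
  \<open>X\<close> because the projection fixes \<open>X\<close>. A vector of the double complement
  of \<open>Z\<close> is orthogonal to the range of \<open>E\<close>, so its projection onto
  \<open>X\<close> is 0 and it lies in \<open>Z\<close>.\<close>

lemma direct_sum_orth_compl:
  assumes ds: "direct_sum_decomp X Z" "complex_vector.subspace X" "complex_vector.subspace Z"
    and adj: "is_adjoint (oblique_proj X Z) E"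
  shows "direct_sum_decomp (orth_compl Z) (orth_compl X)"
    and "oblique_proj (orth_compl Z) (orth_compl X) = E"
    and "orth_compl (orth_compl Z) = Z"
proof -
  have E1: "E h \<in> orth_compl Z" for h
  proof -
    have "cinner (E h) z = 0" if "z \<in> Z" for z
    proof -
      have "oblique_proj X Z z = 0"
        using that ds(2) by (intro oblique_proj_eqI[OF ds]) (auto intro: complex_vector.subspace_0)
      then show ?thesis
        using is_adjointD'[OF adj, of h z] by simp
    qed
    then show ?thesis by (simp add: orth_compl_def)
  qed
  have E2: "h - E h \<in> orth_compl X" for h
    by (auto simp: orth_compl_def cinner_diff_left oblique_proj_eq_self[OF ds]
        simp flip: is_adjointD'[OF adj])
  have sub: "complex_vector.subspace (orth_compl Z)" "complex_vector.subspace (orth_compl X)"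
    using closed_csubspace_orth_compl closed_csubspace_def by blast+
  show ds': "direct_sum_decomp (orth_compl Z) (orth_compl X)"
    unfolding direct_sum_decomp_def
  proof (intro conjI allI)
    have "h = 0" if h: "h \<in> orth_compl Z \<inter> orth_compl X" for h
    proof -
      obtain x z where xz: "x \<in> X" "z \<in> Z" "h = x + z"
        using direct_sumE[OF ds(1)] by blast
      have "cinner h h = cinner h x + cinner h z"
        by (subst (2) xz(3)) (rule cinner_add_right)
      then have "cinner h h = 0"
        using h xz by (simp add: orth_compl_def)
      then show ?thesis by simp
    qed
    then show "orth_compl Z \<inter> orth_compl X = {0}"
      by (auto simp: orth_compl_def)
    show "\<exists>x\<in>orth_compl Z. \<exists>z\<in>orth_compl X. h = x + z" for h
      using E1[of h] E2[of h] by (intro bexI[of _ "E h"] bexI[of _ "h - E h"]) auto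
  qed
  show "oblique_proj (orth_compl Z) (orth_compl X) = E"
    by (rule ext, rule oblique_proj_eqI[OF ds' sub E1 E2])
  have "x \<in> Z" if "x \<in> orth_compl (orth_compl Z)" for x
  proof -
    have "oblique_proj X Z x = 0"
    proof (rule cinner_ext)
      fix y
      have "cinner x (E y) = 0"
        using that E1 by (simp add: orth_compl_def)
      then show "cinner y (oblique_proj X Z x) = cinner y 0"
        by (metis is_adjointD'[OF adj] cinner_commute cinner_zero_right complex_cnj_zero)
    qed
    then show ?thesis
      using oblique_proj_mem(2)[OF ds, of x] by simp
  qed
  moreover have "x \<in> orth_compl (orth_compl Z)" if "x \<in> Z" for x
  proof -
    have "cinner x y = 0" if "y \<in> orth_compl Z" for y
      using that \<open>x \<in> Z\<close> cinner_commute[of x y] by (simp add: orth_compl_def)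
    then show ?thesis
      by (simp add: orth_compl_def[of "orth_compl Z"])
  qed
  ultimately show "orth_compl (orth_compl Z) = Z"
    by blast
qed

text \<open>The residual of the projection lies in \<open>orth_compl Y\<close>, so pairing with a
  vector of \<open>Y\<close> cannot distinguish \<open>x\<close> from its projection.\<close>

lemma adjoint_oblique_proj_eq_self:
  assumes ds: "direct_sum_decomp X (orth_compl Y)" "closed_csubspace X"
    and adj: "is_adjoint (oblique_proj X (orth_compl Y)) E" and h: "h \<in> Y"
  shows "E h = h"
proof (rule cinner_ext)
  fix x
  have "x - oblique_proj X (orth_compl Y) x \<in> orth_compl Y"
    using oblique_proj_mem(2)[OF ds(1)] ds(2) closed_csubspace_orth_compl[of Y]
    by (auto simp: closed_csubspace_def)
  then have "cinner (x - oblique_proj X (orth_compl Y) x) h = 0"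
    using h by (simp add: orth_compl_def)
  then show "cinner x (E h) = cinner x h"
    by (simp add: cinner_diff_left is_adjointD[OF adj])
qed

text \<open>Each sequence serves as the partner of the other in \<open>frame_forI\<close>, so both
  lower frame bounds follow from the operator identity. What remains to check of duality is a Bessel
  bound, a range and one identity.\<close>

lemma oblique_dual_frame_iff:
  fixes F G :: "nat \<Rightarrow> 'a::chilbert_space"
  assumes X: "closed_csubspace X" and Y: "closed_csubspace Y"
    and ds: "direct_sum_decomp X (orth_compl Y)"
    and G: "bessel_in UNIV G" "range G \<subseteq> Y"
  shows "oblique_dual_frame X Y F G \<longleftrightarrow> bessel_in UNIV F \<and> range F \<subseteq> X \<and>
    mixed_frame_op F G = oblique_proj X (orth_compl Y)"
proof
  assume "oblique_dual_frame X Y F G"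
  then show "bessel_in UNIV F \<and> range F \<subseteq> X \<and> mixed_frame_op F G = oblique_proj X (orth_compl Y)"
    by (auto simp: oblique_dual_frame_def frame_for_def bessel_in_iff[OF X] mixed_frame_op_def)
next
  assume R: "bessel_in UNIV F \<and> range F \<subseteq> X \<and> mixed_frame_op F G = oblique_proj X (orth_compl Y)"
  then have F: "bessel_in UNIV F" "range F \<subseteq> X"
    and eq: "mixed_frame_op F G = oblique_proj X (orth_compl Y)"
    by auto
  have sub: "complex_vector.subspace X" "complex_vector.subspace (orth_compl Y)"
    using X closed_csubspace_orth_compl closed_csubspace_def by blast+
  have adj: "is_adjoint (oblique_proj X (orth_compl Y)) (mixed_frame_op G F)"
    unfolding eq[symmetric] by (rule is_adjoint_mixed_frame_op[OF F(1) G(1)])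
  have "frame_for X F"
    using F
  proof (intro frame_forI[OF X _ _ G(1)])
    fix h assume "h \<in> X"
    then show "cinner (mixed_frame_op G F h) h = cinner h h"
      by (simp add: oblique_proj_eq_self[OF ds sub] flip: is_adjointD'[OF adj])
  qed auto
  moreover have "frame_for Y G"
  proof (rule frame_forI[OF Y G(2,1) F(1)])
    fix h assume "h \<in> Y"
    then show "cinner (mixed_frame_op F G h) h = cinner h h"
      by (simp add: eq is_adjointD[OF adj] adjoint_oblique_proj_eq_self[OF ds X adj])
  qed
  ultimately show "oblique_dual_frame X Y F G"
    using X Y ds eq by (simp add: oblique_dual_frame_def mixed_frame_op_def)
qed

text \<open>
  The coefficients \<open>c\<close> below are the difference of two representations of \<open>G k\<close> in the frame \<open>G\<close>: the
  trivial one and the one given by the dual frame \<open>F0\<close>. Hence \<open>c\<close> synthesizes to 0 along \<open>G\<close>, while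
  along \<open>D\<close> it yields \<open>D k\<close> up to a term that depends on \<open>mixed_frame_op D F0\<close> only.
\<close>

lemma mixed_frame_op_eq_on_duals_imp_eq:
  fixes F0 G :: "nat \<Rightarrow> 'a::chilbert_space" and D D' :: "nat \<Rightarrow> 'b::chilbert_space"
  assumes X: "closed_csubspace X" and Y: "closed_csubspace Y"
    and ds: "direct_sum_decomp X (orth_compl Y)"
    and G: "bessel_in UNIV G" "range G \<subseteq> Y"
    and F0: "oblique_dual_frame X Y F0 G"
    and D: "bessel_in UNIV D" "bessel_in UNIV D'"
    and v: "v \<in> X" "v \<noteq> 0"
    and eq: "\<And>F. oblique_dual_frame X Y F G \<Longrightarrow> mixed_frame_op D F = mixed_frame_op D' F"
  shows "D = D'"
proof
  fix k :: nat
  note dual_iff = oblique_dual_frame_iff[OF X Y ds G]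
  have F0': "bessel_in UNIV F0" "range F0 \<subseteq> X" "mixed_frame_op F0 G = oblique_proj X (orth_compl Y)"
    using F0 dual_iff by auto
  have adj: "is_adjoint (oblique_proj X (orth_compl Y)) (mixed_frame_op G F0)"
    unfolding F0'(3)[symmetric] by (rule is_adjoint_mixed_frame_op[OF F0'(1) G(1)])
  define \<delta> where "\<delta> n = (if n = k then 1 else 0 :: complex)" for n
  define c where "c n = \<delta> n - cinner (G k) (F0 n)" for n
  have \<delta>: "summable (\<lambda>n. (cmod (\<delta> n))\<^sup>2)"
    by (rule summable_finite[of "{k}"]) (auto simp: \<delta>_def)
  have GF: "summable (\<lambda>n. (cmod (cinner h (F0 n)))\<^sup>2)" for h
    by (rule summable_cinner_squared[OF F0'(1)])
  have c: "summable (\<lambda>n. (cmod (c n))\<^sup>2)"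
  proof (rule summable_comparison_test')
    show "summable (\<lambda>n. 2 * (cmod (\<delta> n))\<^sup>2 + 2 * (cmod (cinner (G k) (F0 n)))\<^sup>2)"
      by (intro summable_add summable_mult \<delta> GF)
    show "norm ((cmod (c n))\<^sup>2) \<le> 2 * (cmod (\<delta> n))\<^sup>2 + 2 * (cmod (cinner (G k) (F0 n)))\<^sup>2" for n
      using cmod_add_squared_le[of "\<delta> n" "- cinner (G k) (F0 n)"] by (simp add: c_def)
  qed
  have synth_c: "synthesis E c = E k - mixed_frame_op E F0 (G k)"
    if "bessel_in UNIV E" for E :: "nat \<Rightarrow> 'c::chilbert_space"
    unfolding c_def using that synthesis_diff[OF that \<delta> GF] synthesis_unit[of E k]
    by (simp add: \<delta>_def mixed_frame_op_def synthesis_adj_def)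
  \<comment> \<open>The conjugate makes the coefficients of \<open>h\<close> against
    \<open>U\<close> equal to \<open>cinner h v * c n\<close>, so analysis along \<open>U\<close>
    followed by synthesis along any \<open>E\<close> gives a multiple of
    \<open>synthesis E c\<close>.\<close>
  define U where "U n = cnj (c n) *\<^sub>C v" for n
  have U: "bessel_in UNIV U"
    unfolding U_def by (rule bessel_rank_one) (simp add: c)
  have synth_U: "mixed_frame_op E U h = cinner h v *\<^sub>C synthesis E c"
    if "bessel_in UNIV E" for E :: "nat \<Rightarrow> 'c::chilbert_space" and h
    by (simp add: mixed_frame_op_def synthesis_adj_def U_def cinner_scaleC_right mult.commute
        flip: synthesis_scale[OF that c])
  \<comment> \<open>\<open>G k\<close> lies in \<open>Y\<close>, where the adjoint projection is the
    identity; thus the dual frame reproduces \<open>G k\<close>.\<close>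
  have "synthesis G c = 0"
    using adjoint_oblique_proj_eq_self[OF ds X adj, of "G k"] G by (simp add: synth_c subset_iff)
  then have "mixed_frame_op G U = (\<lambda>h. 0)"
    by (simp add: synth_U[OF G(1)] fun_eq_iff)
  \<comment> \<open>Taking adjoints gives the order that occurs in the definition of duality: adding
    \<open>U\<close> to \<open>F0\<close> keeps it a dual of \<open>G\<close>.\<close>
  then have UG: "mixed_frame_op U G = (\<lambda>h. 0)"
    using is_adjoint_mixed_frame_op[OF G(1) U] is_adjoint_unique[of "\<lambda>h. 0" _ "\<lambda>h. 0"]
    by (simp add: is_adjoint_def)
  have sumF: "mixed_frame_op (\<lambda>n. F0 n + U n) G = oblique_proj X (orth_compl Y)"
  proof
    fix h
    have "mixed_frame_op (\<lambda>n. F0 n + U n) G h = mixed_frame_op F0 G h + mixed_frame_op U G h"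
      unfolding mixed_frame_op_apply scaleC_add_right
      by (intro suminf_add[symmetric] summable_mixed_frame_op F0' U G)
    then show "mixed_frame_op (\<lambda>n. F0 n + U n) G h = oblique_proj X (orth_compl Y) h"
      by (simp add: UG F0'(3))
  qed
  have "range (\<lambda>n. F0 n + U n) \<subseteq> X"
    using F0'(2) v closed_csubspaceD(4,6)[OF X] by (auto simp: U_def)
  then have "oblique_dual_frame X Y (\<lambda>n. F0 n + U n) G"
    using dual_iff sumF bessel_add[OF F0'(1) U] by simp
  then have *: "mixed_frame_op D (\<lambda>n. F0 n + U n) v = mixed_frame_op D' (\<lambda>n. F0 n + U n) v"
    by (simp add: eq)
  have split: "mixed_frame_op E (\<lambda>n. F0 n + U n) v = mixed_frame_op E F0 v + mixed_frame_op E U v"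
    if "bessel_in UNIV E" for E :: "nat \<Rightarrow> 'b"
    using synthesis_add[OF that GF summable_cinner_squared[OF U]]
    by (simp add: mixed_frame_op_def synthesis_adj_def cinner_add_right)
  \<comment> \<open>The contributions of \<open>F0\<close> agree for \<open>D\<close> and
    \<open>D'\<close>, leaving those of \<open>U\<close>. Evaluation at \<open>v\<close> gives the
    nonzero factor \<open>cinner v v\<close>, which can be cancelled.\<close>
  have "cinner v v *\<^sub>C synthesis D c = cinner v v *\<^sub>C synthesis D' c"
    using * eq[OF F0] by (simp add: split D synth_U)
  then have "synthesis D c = synthesis D' c"
    using v(2) by simp
  then show "D k = D' k"
    using eq[OF F0] by (simp add: synth_c D)
qed

section \<open>The oblique pseudoinverse, its adjoint and the associated projections\<close>

text \<open>The adjoint \<open>Ms\<close> is a parameter because a multiplier comes with an explicit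
  one; linearity and boundedness of \<open>M\<close> follow from \<open>M_adj\<close>.\<close>

locale oblique_pinv_setting =
  fixes M :: "'a::chilbert_space \<Rightarrow> 'b::chilbert_space" and Ms :: "'b \<Rightarrow> 'a"
    and W :: "'a set" and V :: "'b set"
  assumes M_adj: "is_adjoint M Ms"
    and range_closed: "closed (range M)"
    and W: "closed_csubspace W" and V: "closed_csubspace V"
    and W_ker: "direct_sum_decomp W (op_kernel M)"
    and range_V: "direct_sum_decomp (range M) V"
begin

abbreviation "Mp \<equiv> oblique_pinv M W V"

lemma linear_M: "linear M"
  by (rule is_adjoint_linear[OF M_adj])

lemma scaleC_M: "M (a *\<^sub>C x) = a *\<^sub>C M x"
  by (rule is_adjoint_scaleC[OF M_adj])

lemma range_csubspace: "closed_csubspace (range M)"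
proof -
  have "M x + M y \<in> range M" "a *\<^sub>C M x \<in> range M" "0 \<in> range M" for x y a
    using linear_add[OF linear_M] scaleC_M linear_0[OF linear_M] by (metis rangeI)+
  then show ?thesis
    using range_closed by (auto simp: closed_csubspace_def complex_vector.subspace_def)
qed

lemma kernel_subspace: "complex_vector.subspace (op_kernel M)"
  by (auto simp: complex_vector.subspace_def op_kernel_def linear_0[OF linear_M]
      linear_add[OF linear_M] scaleC_M)

lemma subspaces: "complex_vector.subspace W" "complex_vector.subspace V"
    "complex_vector.subspace (range M)"
  using W V range_csubspace by (auto simp: closed_csubspace_def)

text \<open>Two candidates have the same image since \<open>range M\<close> and \<open>V\<close>
  meet only in 0, and then coincide since \<open>W\<close> meets the kernel only in 0.\<close>

lemma Mp_eqI:
  assumes "x \<in> W" "y - M x \<in> V"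
  shows "Mp y = x"
  unfolding oblique_pinv_def
proof (rule the_equality)
  show "x \<in> W \<and> (\<exists>z\<in>V. y = M x + z)"
    using assms by (intro conjI bexI[of _ "y - M x"]) auto
next
  fix x' assume x': "x' \<in> W \<and> (\<exists>z\<in>V. y = M x' + z)"
  then obtain z where z: "z \<in> V" "y = M x' + z" by blast
  have "M x' = M x"
    by (rule direct_sum_unique(1)[OF range_V subspaces(3,2), of _ z _ "y - M x"])
      (use z assms in auto)
  then have "x' - x \<in> W \<inter> op_kernel M"
    using x' assms closed_csubspaceD(5)[OF W] by (auto simp: op_kernel_def linear_diff[OF linear_M])
  then have "x' - x = 0"
    using W_ker unfolding direct_sum_decomp_def by blast
  then show "x' = x" by simp
qed

lemma Mp_mem: "Mp y \<in> W" "y - M (Mp y) \<in> V"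
proof -
  obtain u z where z: "z \<in> V" "y = M u + z"
    using direct_sumE[OF range_V] by (metis rangeE)
  obtain x k where x: "x \<in> W" "k \<in> op_kernel M" "u = x + k"
    using direct_sumE[OF W_ker] by blast
  have "y - M x = z"
    using x z by (simp add: linear_add[OF linear_M] op_kernel_def)
  moreover from this have "Mp y = x"
    using x z by (intro Mp_eqI) auto
  ultimately show "Mp y \<in> W" "y - M (Mp y) \<in> V"
    using x z by auto
qed

lemma linear_Mp: "linear Mp"
proof (rule linearI)
  fix x y :: 'b and r :: real
  show "Mp (x + y) = Mp x + Mp y"
    using closed_csubspaceD(4)[OF V Mp_mem(2)[of x] Mp_mem(2)[of y]]
    by (intro Mp_eqI closed_csubspaceD(4)[OF W] Mp_mem)
      (simp add: linear_add[OF linear_M] algebra_simps)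
  show "Mp (r *\<^sub>R x) = r *\<^sub>R Mp x"
    using subspace_scale[OF closed_csubspaceD(1)[OF V] Mp_mem(2)[of x], of r]
    by (intro Mp_eqI subspace_scale closed_csubspaceD(1)[OF W] Mp_mem)
      (simp add: linear_scale[OF linear_M] algebra_simps)
qed

lemma scaleC_Mp: "Mp (a *\<^sub>C x) = a *\<^sub>C Mp x"
  using closed_csubspaceD(6)[OF V Mp_mem(2)[of x], of a]
  by (intro Mp_eqI closed_csubspaceD(6)[OF W] Mp_mem)
    (simp add: scaleC_M complex_vector.scale_right_diff_distrib)

text \<open>The graph of \<open>Mp\<close> consists of the pairs \<open>(y, x)\<close> with
  \<open>x \<in> W\<close> and \<open>y - M x \<in> V\<close>. It is closed because \<open>W\<close>
  and \<open>V\<close> are closed and \<open>M\<close> is continuous, so \<open>Mp\<close> is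
  bounded and has an adjoint.\<close>

lemma Mp_adjoint: "is_adjoint Mp (cadjoint Mp)"
proof -
  have "bounded_linear Mp"
  proof (rule closed_graph_bounded_linear[OF linear_Mp])
    fix y b x
    assume lim: "y \<longlonglongrightarrow> b" "(\<lambda>n. Mp (y n)) \<longlonglongrightarrow> x"
    have "x \<in> W"
      using closed_csubspaceD(2)[OF W] Mp_mem(1) lim(2) by (rule closed_sequentially)
    moreover have "(\<lambda>n. y n - M (Mp (y n))) \<longlonglongrightarrow> b - M x"
      by (intro tendsto_diff lim bounded_linear.tendsto[OF is_adjoint_bounded_linear[OF M_adj]])
    then have "b - M x \<in> V"
      by (rule closed_sequentially[OF closed_csubspaceD(2)[OF V] Mp_mem(2)])
    ultimately show "Mp b = x"
      by (rule Mp_eqI)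
  qed
  then obtain K where "is_adjoint Mp K"
    using is_adjoint_exists scaleC_Mp by blast
  then show ?thesis
    using cadjoint_eqI by blast
qed

abbreviation "Mps \<equiv> cadjoint Mp"

lemma oblique_proj_range: "oblique_proj (range M) V = M \<circ> Mp"
  by (rule ext, rule oblique_proj_eqI[OF range_V subspaces(3,2)]) (simp_all add: Mp_mem)

lemma oblique_proj_W: "oblique_proj W (op_kernel M) = Mp \<circ> M"
proof (rule ext, rule oblique_proj_eqI[OF W_ker subspaces(1) kernel_subspace])
  fix h
  show "(Mp \<circ> M) h \<in> W"
    by (simp add: Mp_mem)
  have "oblique_proj (range M) V (M h) = M h"
    by (rule oblique_proj_eq_self[OF range_V subspaces(3,2)]) simp
  then show "h - (Mp \<circ> M) h \<in> op_kernel M"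
    by (simp add: oblique_proj_range op_kernel_def linear_diff[OF linear_M])
qed

lemma Mp_M_Mp [simp]: "Mp (M (Mp y)) = Mp y"
  using oblique_proj_eq_self[OF W_ker subspaces(1) kernel_subspace Mp_mem(1)]
  by (simp add: oblique_proj_W)

lemma Mps_Ms_Mps [simp]: "Mps (Ms (Mps x)) = Mps x"
proof -
  have "is_adjoint (Mp \<circ> (M \<circ> Mp)) (Mps \<circ> Ms \<circ> Mps)"
    by (intro is_adjoint_comp Mp_adjoint M_adj)
  moreover have "Mp \<circ> (M \<circ> Mp) = Mp"
    by (simp add: fun_eq_iff)
  ultimately show ?thesis
    using is_adjoint_unique[OF Mp_adjoint] by (metis comp_apply)
qed

lemma adjoint_proj_range: "is_adjoint (oblique_proj (range M) V) (Mps \<circ> Ms)"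
  unfolding oblique_proj_range by (intro is_adjoint_comp Mp_adjoint M_adj)

lemma adjoint_proj_W: "is_adjoint (oblique_proj W (op_kernel M)) (Ms \<circ> Mps)"
  unfolding oblique_proj_W by (intro is_adjoint_comp Mp_adjoint M_adj)

text \<open>On the adjoint side, \<open>Mps \<circ> Ms\<close> is the projection onto
  \<open>orth_compl V\<close> along \<open>orth_compl (range M)\<close>, and
  \<open>Ms \<circ> Mps\<close> the one onto \<open>orth_compl (op_kernel M)\<close> along
  \<open>orth_compl W\<close>.\<close>

lemmas orth_V = direct_sum_orth_compl[OF range_V subspaces(3,2) adjoint_proj_range]
lemmas orth_ker = direct_sum_orth_compl[OF W_ker subspaces(1) kernel_subspace adjoint_proj_W]

lemma Mps_mem: "Mps x \<in> orth_compl V"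
proof -
  have "oblique_proj (orth_compl V) (orth_compl (range M)) (Mps x) = Mps x"
    by (simp add: orth_V(2))
  then show ?thesis
    using oblique_proj_mem(1)[OF orth_V(1)] closed_csubspace_orth_compl
    by (metis closed_csubspace_def)
qed

lemma Ms_Mps_mem: "Ms (Mps x) \<in> orth_compl (op_kernel M)"
proof -
  have "oblique_proj (orth_compl (op_kernel M)) (orth_compl W) x \<in> orth_compl (op_kernel M)"
    using closed_csubspace_orth_compl closed_csubspace_def
    by (intro oblique_proj_mem(1)[OF orth_ker(1)]) blast+
  then show ?thesis
    by (simp add: orth_ker(2))
qed

text \<open>If either space is zero, \<open>Mp\<close> and its adjoint vanish, and with them the
  projection onto the other space. This isolates the degenerate case of the uniqueness claims, where
  no nonzero test vector exists.\<close>

lemma trivial_iff: "W = {0} \<longleftrightarrow> orth_compl V = {0}"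
proof
  assume L: "W = {0}"
  then have "Mp = (\<lambda>y. 0)"
    using Mp_mem(1) by auto
  then have "Mps = (\<lambda>x. 0)"
    using Mp_adjoint is_adjoint_unique[of "\<lambda>y. 0" _ "\<lambda>x. 0"] by (simp add: is_adjoint_def)
  then have "y = 0" if "y \<in> orth_compl V" for y
    using oblique_proj_eq_self[OF orth_V(1) _ _ that] closed_csubspace_orth_compl
    unfolding orth_V(2) by (auto simp: closed_csubspace_def)
  then show "orth_compl V = {0}"
    by (auto simp: orth_compl_def)
next
  assume "orth_compl V = {0}"
  then have "Mps = (\<lambda>x. 0)"
    using Mps_mem by auto
  then have "Mp = (\<lambda>y. 0)"
    using is_adjoint_sym[OF Mp_adjoint] is_adjoint_unique[of "\<lambda>y. 0" _ "\<lambda>x. 0"]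
    by (simp add: is_adjoint_def)
  then have "x = 0" if "x \<in> W" for x
    using oblique_proj_eq_self[OF W_ker subspaces(1) kernel_subspace that]
    by (simp add: oblique_proj_W)
  then show "W = {0}"
    using closed_csubspaceD(3)[OF W] by auto
qed

end

section \<open>Multipliers\<close>

lemma semi_normalizedE:
  assumes "semi_normalized m"
  obtains C D where "\<And>n. m n \<noteq> 0" "\<And>n. cmod (m n) \<le> C" "\<And>n. cmod (1 / m n) \<le> D"
proof -
  define I where "I = (INF n. cmod (m n))"
  have I: "I > 0" and bdd: "bdd_above (range (\<lambda>n. cmod (m n)))"
    using assms by (simp_all add: semi_normalized_def I_def)
  have "bdd_below (range (\<lambda>n. cmod (m n)))"
    by (rule bdd_belowI[of _ 0]) auto
  then have le: "I \<le> cmod (m n)" for n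
    unfolding I_def by (rule cINF_lower) simp
  show thesis
  proof
    show "m n \<noteq> 0" for n
      using le[of n] I by auto
    show "cmod (m n) \<le> (SUP n. cmod (m n))" for n
      using bdd by (rule cSUP_upper[rotated]) simp
    show "cmod (1 / m n) \<le> 1 / I" for n
      using le[of n] I by (simp add: norm_divide frac_le)
  qed
qed

theorem proposition6p1:
  fixes \<Psi> :: "nat \<Rightarrow> 'a::chilbert_space"
    and \<Phi> :: "nat \<Rightarrow> 'b::chilbert_space"
    and m :: "nat \<Rightarrow> complex"
    and W :: "'a set" and V :: "'b set"
  defines "M \<equiv> multiplier m \<Phi> \<Psi>"
  defines "Mp \<equiv> oblique_pinv M W V"
  defines "\<Psi>s \<equiv> (\<lambda>n. Mp (m n *\<^sub>C \<Phi> n))"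
    and "\<Phi>s \<equiv> (\<lambda>n. cadjoint Mp (cnj (m n) *\<^sub>C \<Psi> n))"
  defines "P\<Phi> \<equiv> (\<lambda>n. oblique_proj (range M) V (\<Phi> n))"
    and "Q\<Psi> \<equiv> (\<lambda>n. cadjoint (oblique_proj W (op_kernel M)) (\<Psi> n))"
  assumes "separable_space (euclidean :: 'a topology)"
    and "separable_space (euclidean :: 'b topology)"
    and "bessel_in UNIV \<Psi>" and "bessel_in UNIV \<Phi>"
    and "semi_normalized m"
    and "closed (range M)"
    and "closed_csubspace W" and "closed_csubspace V"
    and "direct_sum_decomp W (op_kernel M)"
    and "direct_sum_decomp (range M) V"
  shows "(\<forall>F. bessel_in (orth_compl V) F \<and> Mp = multiplier (\<lambda>n. 1 / m n) \<Psi>s F \<longrightarrow>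
             oblique_dual_frame (orth_compl V) (range M) F P\<Phi>)
       \<and> (\<forall>G. bessel_in W G \<and> Mp = multiplier (\<lambda>n. 1 / m n) G \<Phi>s \<longrightarrow>
             oblique_dual_frame W (orth_compl (op_kernel M)) G Q\<Psi>)
       \<and> (\<forall>G. bessel_in W G \<and>
             (\<forall>\<Phi>od. oblique_dual_frame (orth_compl V) (range M) \<Phi>od P\<Phi> \<longrightarrow>
                 Mp = multiplier (\<lambda>n. 1 / m n) G \<Phi>od)
             \<longleftrightarrow> G = \<Psi>s)
       \<and> (\<forall>F. bessel_in (orth_compl V) F \<and>
             (\<forall>\<Psi>od. oblique_dual_frame W (orth_compl (op_kernel M)) \<Psi>od Q\<Psi> \<longrightarrow>
                 Mp = multiplier (\<lambda>n. 1 / m n) \<Psi>od F)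
             \<longleftrightarrow> F = \<Phi>s)"
proof -
  obtain C D where m: "\<And>n. m n \<noteq> 0" "\<And>n. cmod (m n) \<le> C" "\<And>n. cmod (1 / m n) \<le> D"
    using semi_normalizedE[OF \<open>semi_normalized m\<close>] by blast
  note \<Psi> = \<open>bessel_in UNIV \<Psi>\<close> and \<Phi> = \<open>bessel_in UNIV \<Phi>\<close>
  define \<Psi>w where "\<Psi>w n = cnj (m n) *\<^sub>C \<Psi> n" for n
  define Ms where "Ms = mixed_frame_op \<Psi>w \<Phi>"
  have \<Psi>w: "bessel_in UNIV \<Psi>w"
    unfolding \<Psi>w_def by (rule bessel_weighted[OF \<Psi>, where C = C]) (simp add: m)
  have M_eq: "M = mixed_frame_op \<Phi> \<Psi>w"
    unfolding M_def \<Psi>w_def by (rule multiplier_eq_weight_right)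
  have M_adj: "is_adjoint M Ms"
    unfolding M_eq Ms_def by (rule is_adjoint_mixed_frame_op[OF \<Phi> \<Psi>w])
  interpret oblique_pinv_setting M Ms W V
    rewrites "oblique_pinv M W V \<equiv> Mp"
    using assms M_adj by unfold_locales (simp_all add: Mp_def)
  have W': "closed_csubspace W" and V': "closed_csubspace (orth_compl V)"
    and R': "closed_csubspace (range M)" and K': "closed_csubspace (orth_compl (op_kernel M))"
    by (rule W closed_csubspace_orth_compl range_csubspace)+

  have P\<Phi>_eq: "P\<Phi> = (\<lambda>n. M (Mp (\<Phi> n)))"
    by (simp add: P\<Phi>_def oblique_proj_range)
  have Q\<Psi>_eq: "Q\<Psi> = (\<lambda>n. Ms (cadjoint Mp (\<Psi> n)))"
    by (simp add: Q\<Psi>_def cadjoint_eqI[OF adjoint_proj_W])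
  have \<Phi>s_eq: "\<Phi>s = (\<lambda>n. cadjoint Mp (\<Psi>w n))"
    by (simp add: \<Phi>s_def \<Psi>w_def)
  have Mp\<Phi>: "bessel_in UNIV (\<lambda>n. Mp (\<Phi> n))"
    by (rule bessel_image[OF \<Phi> Mp_adjoint])
  have Mps\<Psi>: "bessel_in UNIV (\<lambda>n. cadjoint Mp (\<Psi> n))"
    by (rule bessel_image[OF \<Psi> is_adjoint_sym[OF Mp_adjoint]])
  have P\<Phi>: "bessel_in UNIV P\<Phi>" "range P\<Phi> \<subseteq> range M"
    unfolding P\<Phi>_eq using bessel_image[OF Mp\<Phi> M_adj] by auto
  have Q\<Psi>: "bessel_in UNIV Q\<Psi>" "range Q\<Psi> \<subseteq> orth_compl (op_kernel M)"
    unfolding Q\<Psi>_eq using bessel_image[OF Mps\<Psi> is_adjoint_sym[OF M_adj]] Ms_Mps_mem by auto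
  have \<Phi>s: "bessel_in UNIV \<Phi>s" "range \<Phi>s \<subseteq> orth_compl V"
    unfolding \<Phi>s_eq using bessel_image[OF \<Psi>w is_adjoint_sym[OF Mp_adjoint]] Mps_mem by auto
  have \<Psi>s: "bessel_in UNIV \<Psi>s" "range \<Psi>s \<subseteq> W"
    unfolding \<Psi>s_def
    using bessel_image[OF bessel_weighted[OF \<Phi> m(2)] Mp_adjoint] Mp_mem(1) by auto

  have inv_\<Psi>s: "(\<lambda>n. (1 / m n) *\<^sub>C \<Psi>s n) = (\<lambda>n. Mp (\<Phi> n))"
    using m(1) by (simp add: \<Psi>s_def scaleC_Mp scaleC_scaleC)
  have inv_\<Phi>s: "(\<lambda>n. cnj (1 / m n) *\<^sub>C \<Phi>s n) = (\<lambda>n. cadjoint Mp (\<Psi> n))"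
    using m(1) by (simp add: \<Phi>s_def is_adjoint_scaleC[OF is_adjoint_sym[OF Mp_adjoint]] scaleC_scaleC)
  have mult_\<Psi>s: "multiplier (\<lambda>n. 1 / m n) \<Psi>s F = mixed_frame_op (\<lambda>n. Mp (\<Phi> n)) F" for F :: "nat \<Rightarrow> 'b"
    unfolding multiplier_eq_weight_left inv_\<Psi>s ..
  have mult_\<Phi>s: "multiplier (\<lambda>n. 1 / m n) G \<Phi>s = mixed_frame_op G (\<lambda>n. cadjoint Mp (\<Psi> n))" for G :: "nat \<Rightarrow> 'a"
    unfolding multiplier_eq_weight_right inv_\<Phi>s ..

  \<comment> \<open>The definition of duality has \<open>F\<close> as synthesis sequence and
    projects onto \<open>orth_compl V\<close>. Taking adjoints puts \<open>F\<close> on the analysis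
    side and yields the projection \<open>M \<circ> Mp\<close> onto \<open>range M\<close>, which
    matches the multipliers below.\<close>
  have dual_P: "oblique_dual_frame (orth_compl V) (range M) F P\<Phi> \<longleftrightarrow>
      bessel_in (orth_compl V) F \<and> mixed_frame_op P\<Phi> F = M \<circ> Mp" for F
  proof -
    have "mixed_frame_op F P\<Phi> = cadjoint Mp \<circ> Ms \<longleftrightarrow> mixed_frame_op P\<Phi> F = M \<circ> Mp" if "bessel_in UNIV F"
      using is_adjoint_mixed_frame_op[OF that P\<Phi>(1)] is_adjoint_mixed_frame_op[OF P\<Phi>(1) that]
        adjoint_proj_range[unfolded oblique_proj_range] is_adjoint_sym is_adjoint_unique
      by metis
    then show ?thesis
      using oblique_dual_frame_iff[OF V' R' orth_V(1) P\<Phi>, of F] bessel_in_iff[OF V', of F]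
      by (auto simp: orth_V(2))
  qed
  \<comment> \<open>The second space is itself an orthogonal complement, so duality refers to a
    double complement, which is the kernel again.\<close>
  have ds_Q: "direct_sum_decomp W (orth_compl (orth_compl (op_kernel M)))"
    by (simp add: orth_ker(3) W_ker)
  have dual_Q: "oblique_dual_frame W (orth_compl (op_kernel M)) G Q\<Psi> \<longleftrightarrow>
      bessel_in W G \<and> mixed_frame_op G Q\<Psi> = Mp \<circ> M" for G
    using oblique_dual_frame_iff[OF W' K' ds_Q Q\<Psi>, of G] bessel_in_iff[OF W', of G]
    by (auto simp: orth_ker(3) oblique_proj_W)

  \<comment> \<open>From representations of the pseudoinverse to oblique duals\<close>
  have i: "oblique_dual_frame (orth_compl V) (range M) F P\<Phi>"
    if F: "bessel_in (orth_compl V) F" and eq: "Mp = multiplier (\<lambda>n. 1 / m n) \<Psi>s F" for F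
  proof -
    have "mixed_frame_op (\<lambda>n. Mp (\<Phi> n)) F = Mp"
      using eq unfolding mult_\<Psi>s by (rule sym)
    then have "mixed_frame_op P\<Phi> F h = M (Mp h)" for h
      using mixed_frame_op_image_left[OF M_adj Mp\<Phi>, of F h] F
      by (simp add: P\<Phi>_eq bessel_in_iff[OF V'])
    then show ?thesis
      using F by (simp add: dual_P fun_eq_iff)
  qed
  have ii: "oblique_dual_frame W (orth_compl (op_kernel M)) G Q\<Psi>"
    if G: "bessel_in W G" and eq: "Mp = multiplier (\<lambda>n. 1 / m n) G \<Phi>s" for G
  proof -
    have "mixed_frame_op G (\<lambda>n. cadjoint Mp (\<Psi> n)) = Mp"
      using eq unfolding mult_\<Phi>s by (rule sym)
    then have "mixed_frame_op G Q\<Psi> h = Mp (M h)" for h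
      using mixed_frame_op_image_right[OF M_adj, of G "\<lambda>n. cadjoint Mp (\<Psi> n)" h]
      by (simp add: Q\<Psi>_eq)
    then show ?thesis
      using G by (simp add: dual_Q fun_eq_iff)
  qed

  \<comment> \<open>The canonical sequences represent the pseudoinverse with every dual\<close>
  have canonical: "Mp = multiplier (\<lambda>n. 1 / m n) \<Psi>s \<Phi>s"
  proof
    fix h
    \<comment> \<open>The adjoint of \<open>Mp\<close> leaves the analysis sequence and acts on
      \<open>h\<close> as \<open>Mp\<close>, and \<open>Mp\<close> leaves the synthesis sequence to
      the front; the middle is \<open>M\<close>.\<close>
    have "multiplier (\<lambda>n. 1 / m n) \<Psi>s \<Phi>s h = mixed_frame_op (\<lambda>n. Mp (\<Phi> n)) \<Psi>w (Mp h)"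
      unfolding mult_\<Psi>s \<Phi>s_eq by (rule mixed_frame_op_image_right[OF Mp_adjoint, symmetric])
    also have "\<dots> = Mp (M (Mp h))"
      unfolding M_eq by (rule mixed_frame_op_image_left[OF Mp_adjoint \<Phi> \<Psi>w, symmetric])
    finally show "Mp h = multiplier (\<lambda>n. 1 / m n) \<Psi>s \<Phi>s h"
      by simp
  qed
  \<comment> \<open>The canonical pair shows that duals exist; \<open>\<Phi>s\<close> and
    \<open>\<Psi>s\<close> are the base duals perturbed in the uniqueness arguments.\<close>
  have dual_\<Phi>s: "oblique_dual_frame (orth_compl V) (range M) \<Phi>s P\<Phi>"
    using i canonical \<Phi>s by (simp add: bessel_in_iff[OF V'])
  have dual_\<Psi>s: "oblique_dual_frame W (orth_compl (op_kernel M)) \<Psi>s Q\<Psi>"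
    using ii canonical \<Psi>s by (simp add: bessel_in_iff[OF W'])

  have fwd_\<Psi>s: "Mp = mixed_frame_op (\<lambda>n. Mp (\<Phi> n)) F"
    if F: "oblique_dual_frame (orth_compl V) (range M) F P\<Phi>" for F
  proof
    fix h
    \<comment> \<open>By \<open>Mp_M_Mp\<close>, applying \<open>Mp\<close> to the terms of
      \<open>P\<Phi>\<close> returns \<open>Mp (\<Phi> n)\<close>, and applied to
      \<open>M (Mp h)\<close> it returns \<open>Mp h\<close>.\<close>
    have "Mp (mixed_frame_op P\<Phi> F h) = mixed_frame_op (\<lambda>n. Mp (P\<Phi> n)) F h"
      using F by (intro mixed_frame_op_image_left[OF Mp_adjoint P\<Phi>(1)])
        (simp add: dual_P bessel_in_iff[OF V'])
    moreover have "mixed_frame_op P\<Phi> F h = M (Mp h)"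
      using F by (simp add: dual_P)
    ultimately show "Mp h = mixed_frame_op (\<lambda>n. Mp (\<Phi> n)) F h"
      by (simp add: P\<Phi>_eq)
  qed
  have fwd_\<Phi>s: "Mp = mixed_frame_op G (\<lambda>n. cadjoint Mp (\<Psi> n))"
    if G: "oblique_dual_frame W (orth_compl (op_kernel M)) G Q\<Psi>" for G
  proof
    fix h
    \<comment> \<open>The projection onto \<open>W\<close> fixes \<open>Mp h\<close>. Moving
      \<open>Mp\<close> into the analysis sequence applies its adjoint to \<open>Q\<Psi>\<close>,
      which collapses by \<open>Mps_Ms_Mps\<close>.\<close>
    have "mixed_frame_op G Q\<Psi> (Mp h) = Mp h"
      using G by (simp add: dual_Q)
    then show "Mp h = mixed_frame_op G (\<lambda>n. cadjoint Mp (\<Psi> n)) h"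
      by (simp add: mixed_frame_op_image_right[OF Mp_adjoint] Q\<Psi>_eq)
  qed

  \<comment> \<open>Uniqueness of the canonical sequences\<close>
  have iii: "bessel_in W G \<and> (\<forall>\<Phi>od. oblique_dual_frame (orth_compl V) (range M) \<Phi>od P\<Phi> \<longrightarrow>
      Mp = multiplier (\<lambda>n. 1 / m n) G \<Phi>od) \<longleftrightarrow> G = \<Psi>s" for G
  proof
    assume "G = \<Psi>s"
    then show "bessel_in W G \<and> (\<forall>\<Phi>od. oblique_dual_frame (orth_compl V) (range M) \<Phi>od P\<Phi> \<longrightarrow>
        Mp = multiplier (\<lambda>n. 1 / m n) G \<Phi>od)"
      using \<Psi>s fwd_\<Psi>s by (simp add: bessel_in_iff[OF W'] mult_\<Psi>s)
  next
    assume G: "bessel_in W G \<and> (\<forall>\<Phi>od. oblique_dual_frame (orth_compl V) (range M) \<Phi>od P\<Phi> \<longrightarrow>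
        Mp = multiplier (\<lambda>n. 1 / m n) G \<Phi>od)"
    then have G': "bessel_in UNIV G" "range G \<subseteq> W"
      by (simp_all add: bessel_in_iff[OF W'])
    show "G = \<Psi>s"
    proof (cases "W = {0}")
      case True
      then show ?thesis using G'(2) \<Psi>s(2) by (simp add: fun_eq_iff image_subset_iff)
    next
      case False
      \<comment> \<open>The test vector must come from \<open>orth_compl V\<close>, where the duals
        of \<open>P\<Phi>\<close> live, although the case distinction is on
        \<open>W\<close>.\<close>
      then obtain v where v: "v \<in> orth_compl V" "v \<noteq> 0"
        using trivial_iff closed_csubspaceD(3)[OF V'] by auto
      have "(\<lambda>n. (1 / m n) *\<^sub>C G n) = (\<lambda>n. Mp (\<Phi> n))"
      proof (rule mixed_frame_op_eq_on_duals_imp_eq[OF V' R' orth_V(1) P\<Phi> dual_\<Phi>s _ Mp\<Phi> v])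
        show "bessel_in UNIV (\<lambda>n. (1 / m n) *\<^sub>C G n)"
          by (rule bessel_weighted[OF G'(1) m(3)])
        fix F assume F: "oblique_dual_frame (orth_compl V) (range M) F P\<Phi>"
        then have "Mp = mixed_frame_op (\<lambda>n. (1 / m n) *\<^sub>C G n) F"
          using G unfolding multiplier_eq_weight_left by blast
        then show "mixed_frame_op (\<lambda>n. (1 / m n) *\<^sub>C G n) F = mixed_frame_op (\<lambda>n. Mp (\<Phi> n)) F"
          using fwd_\<Psi>s[OF F] by (rule trans[OF sym])
      qed
      then have "(1 / m n) *\<^sub>C G n = (1 / m n) *\<^sub>C \<Psi>s n" for n
        unfolding inv_\<Psi>s[symmetric] by (rule fun_cong)
      then show ?thesis
        using m(1) by (simp add: fun_eq_iff)
    qed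
  qed

  have iv: "bessel_in (orth_compl V) F \<and>
      (\<forall>\<Psi>od. oblique_dual_frame W (orth_compl (op_kernel M)) \<Psi>od Q\<Psi> \<longrightarrow>
        Mp = multiplier (\<lambda>n. 1 / m n) \<Psi>od F) \<longleftrightarrow> F = \<Phi>s" for F
  proof
    assume "F = \<Phi>s"
    then show "bessel_in (orth_compl V) F \<and>
        (\<forall>\<Psi>od. oblique_dual_frame W (orth_compl (op_kernel M)) \<Psi>od Q\<Psi> \<longrightarrow>
          Mp = multiplier (\<lambda>n. 1 / m n) \<Psi>od F)"
      using \<Phi>s fwd_\<Phi>s by (simp add: bessel_in_iff[OF V'] mult_\<Phi>s)
  next
    assume F: "bessel_in (orth_compl V) F \<and>
        (\<forall>\<Psi>od. oblique_dual_frame W (orth_compl (op_kernel M)) \<Psi>od Q\<Psi> \<longrightarrow>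
          Mp = multiplier (\<lambda>n. 1 / m n) \<Psi>od F)"
    then have F': "bessel_in UNIV F" "range F \<subseteq> orth_compl V"
      by (simp_all add: bessel_in_iff[OF V'])
    show "F = \<Phi>s"
    proof (cases "W = {0}")
      case True
      then have "orth_compl V = {0}" using trivial_iff by simp
      then show ?thesis using F'(2) \<Phi>s(2) by (simp add: fun_eq_iff image_subset_iff)
    next
      case False
      then obtain v where v: "v \<in> W" "v \<noteq> 0"
        using closed_csubspaceD(3)[OF W'] by auto
      have bF: "bessel_in UNIV (\<lambda>n. cnj (1 / m n) *\<^sub>C F n)"
        by (rule bessel_weighted[OF F'(1), where C = D]) (simp only: complex_mod_cnj m(3))
      have "(\<lambda>n. cnj (1 / m n) *\<^sub>C F n) = (\<lambda>n. cadjoint Mp (\<Psi> n))"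
      proof (rule mixed_frame_op_eq_on_duals_imp_eq[OF W' K' ds_Q Q\<Psi> dual_\<Psi>s bF Mps\<Psi> v])
        fix G assume G: "oblique_dual_frame W (orth_compl (op_kernel M)) G Q\<Psi>"
        then have bG: "bessel_in UNIV G"
          by (simp add: dual_Q bessel_in_iff[OF W'])
        have "Mp = mixed_frame_op G (\<lambda>n. cnj (1 / m n) *\<^sub>C F n)"
          using G F unfolding multiplier_eq_weight_right by blast
        \<comment> \<open>Here the dual \<open>G\<close> is the synthesis sequence, whereas the
          uniqueness lemma varies the analysis sequence; both representations of \<open>Mp\<close>
          are therefore replaced by their adjoints.\<close>
        then have "is_adjoint Mp (mixed_frame_op (\<lambda>n. cnj (1 / m n) *\<^sub>C F n) G)"
          using is_adjoint_mixed_frame_op[OF bG bF] by simp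
        moreover have "is_adjoint Mp (mixed_frame_op (\<lambda>n. cadjoint Mp (\<Psi> n)) G)"
          by (subst fwd_\<Phi>s[OF G]) (rule is_adjoint_mixed_frame_op[OF bG Mps\<Psi>])
        ultimately show "mixed_frame_op (\<lambda>n. cnj (1 / m n) *\<^sub>C F n) G = mixed_frame_op (\<lambda>n. cadjoint Mp (\<Psi> n)) G"
          by (rule is_adjoint_unique)
      qed
      then have "cnj (1 / m n) *\<^sub>C F n = cnj (1 / m n) *\<^sub>C \<Phi>s n" for n
        unfolding inv_\<Phi>s[symmetric] by (rule fun_cong)
      then show ?thesis
        using m(1) by (simp add: fun_eq_iff)
    qed
  qed
  show ?thesis
    using i ii iii iv by blast
qed

end
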